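(* Let $\mathrm{MAJ}_n\colon\{-1,1\}^n\to\{-1,1\}$ be the majority function. Then \[\mathrm{rdeg}_\epsilon(\mathrm{MAJ}_n)=\begin{cases}\Theta\left(\log\left\{\frac{2n}{\log(1/\epsilon)}\right\}\cdot\log\frac1\epsilon\right), & 2^{-n}<\epsilon<1/3,\\[2mm] \Theta\left(1+\frac{\log n}{\log\{1/(1-\epsilon)\}}\right), & 1/3\leq\epsilon<1.\end{cases}\]
   Context: $\mathrm{MAJ}_n(x)=1$ if $\sum_i x_i>0$ and $-1$ otherwise. For $h\colon Z\to\{-1,1\}$, $\mathrm{rdeg}_\epsilon(h)$ is the least degree of a rational function $A=p/q$ (with $q$ nonvanishing on $Z$) with $\max_{z\in Z}|h(z)-A(z)|\leq\epsilon$, where the degree of $p/q$ is $\max(\deg p,\deg q)$ (total degrees). *)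

theory Defs
  imports Complex_Main "HOL-Library.FuncSet" "HOL-Library.Poly_Mapping"
begin

text \<open>
  Real multivariate polynomials are finitely supported maps from monomials (exponent vectors
  over the variable indices \<^typ>\<open>nat\<close>) to coefficients.
\<close>

type_synonym real_mpoly = "(nat \<Rightarrow>\<^sub>0 nat) \<Rightarrow>\<^sub>0 real"

definition mpoly_in_vars :: "nat \<Rightarrow> real_mpoly \<Rightarrow> bool" where
  "mpoly_in_vars n p \<longleftrightarrow> (\<forall>m \<in> Poly_Mapping.keys p. Poly_Mapping.keys m \<subseteq> {..<n})"

definition mpoly_eval :: "real_mpoly \<Rightarrow> (nat \<Rightarrow> real) \<Rightarrow> real" where
  "mpoly_eval p x =
     (\<Sum>m \<in> Poly_Mapping.keys p. Poly_Mapping.lookup p m *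
        (\<Prod>i \<in> Poly_Mapping.keys m. x i ^ Poly_Mapping.lookup m i))"

definition monom_degree :: "(nat \<Rightarrow>\<^sub>0 nat) \<Rightarrow> nat" where
  "monom_degree m = (\<Sum>i \<in> Poly_Mapping.keys m. Poly_Mapping.lookup m i)"

text \<open>The zero polynomial gets degree \<open>0\<close>.\<close>

definition total_degree :: "real_mpoly \<Rightarrow> nat" where
  "total_degree p = Max (insert 0 (monom_degree ` Poly_Mapping.keys p))"

text \<open>
  A point of \<open>\<real>\<^sup>n\<close> is a function on indices of which only the values at \<open>0, \<dots>, n - 1\<close> matter,
  since the polynomials involve these variables only. For finite \<open>Z\<close> and \<open>\<epsilon> \<ge> 0\<close> the set of
  degrees minimized over is nonempty, by interpolation.
\<close>

definition rdeg :: "nat \<Rightarrow> (nat \<Rightarrow> real) set \<Rightarrow> real \<Rightarrow> ((nat \<Rightarrow> real) \<Rightarrow> real) \<Rightarrow> nat" where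
  "rdeg n Z \<epsilon> h =
     (LEAST d. \<exists>p q. mpoly_in_vars n p \<and> mpoly_in_vars n q \<and>
        d = max (total_degree p) (total_degree q) \<and>
        (\<forall>z\<in>Z. mpoly_eval q z \<noteq> 0) \<and>
        (\<forall>z\<in>Z. \<bar>h z - mpoly_eval p z / mpoly_eval q z\<bar> \<le> \<epsilon>))"

definition cube :: "nat \<Rightarrow> (nat \<Rightarrow> real) set" where
  "cube n = ({..<n} \<rightarrow>\<^sub>E {-1, 1})"

definition MAJ :: "nat \<Rightarrow> (nat \<Rightarrow> real) \<Rightarrow> real" where
  "MAJ n x = (if (\<Sum>i<n. x i) > 0 then 1 else -1)"

end

theory Submission
  imports Defs "HOL-Computational_Algebra.Fundamental_Theorem_Algebra"
begin

text \<open>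
  Symmetrizing \<open>p q\<close> and \<open>q\<^sup>2\<close> over the layers of the cube turns an approximant \<open>p / q\<close> of
  the majority into a univariate approximant \<open>P / Q\<close> of the sign function on the odd integers of
  absolute value at most \<open>n\<close>; conversely a univariate approximant is evaluated at the sum of the
  coordinates, shifted to be odd.

  Upper bounds: if \<open>R(x) = (\<Prod>i. (a\<^sub>i - x) / (a\<^sub>i + x))\<close> is small for \<open>x > 0\<close>, then Newman's function
  \<open>(1 - R) / (1 + R)\<close> approximates the sign. For small \<open>\<epsilon>\<close> take \<open>k \<approx> log (1 / \<epsilon>)\<close> and the points
  \<open>1, \<dots>, k\<close>, at which \<open>R\<close> vanishes, together with the points \<open>k 2\<^sup>j\<close> of multiplicity \<open>k\<close>; for large
  \<open>\<epsilon>\<close> take a geometric progression of ratio \<open>((1 + \<epsilon>) / (1 - \<epsilon>))\<^sup>1\<^sup>/\<^sup>2\<close>.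

  Lower bounds: let \<open>U = Q - P\<close> and \<open>V = Q + P\<close>. The polynomial \<open>W(x) = U(x) V(-x)\<close>
  satisfies \<open>\<bar>W(x)\<bar> \<le> \<epsilon>\<^sup>2 \<bar>W(-x)\<bar>\<close> at the positive odd \<open>x\<close>. Taking logarithms and summing with weights
  \<open>1 / x\<close> over those \<open>x\<close> that are not within distance \<open>1\<close> of the modulus of a root, each root accounts
  for at most \<open>2 \<pi>\<close>, while at most \<open>deg W\<close> points are left out. When \<open>\<epsilon>\<close> is close to \<open>1\<close>, the
  approximant is first composed with a Newman function of degree of order \<open>log (1 / (1 - \<epsilon>))\<close>, which
  reduces the error to a constant.
\<close>

section \<open>Polynomials decaying on one side of the origin\<close>

text \<open>With \<open>y = t^2\<close> this is \<open>2 ln t <= t - 1 / t\<close>, that is,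
  \<open>u <= sinh u\<close> for \<open>u = ln t\<close>. At
  \<open>y = (x + r) / \<bar>x - r\<bar>\<close> the right side becomes algebraic, with the square
  root that occurs in the derivative of the arcsine.\<close>

lemma ln_le_sqrt_diff:
  fixes y :: real
  assumes "1 \<le> y"
  shows "ln y \<le> (y - 1) / sqrt y"
proof -
  define t where "t = sqrt y"
  have t: "1 \<le> t" "y = t\<^sup>2" using assms by (auto simp: t_def)
  have "1 - 1/1 - 2 * ln 1 \<le> t - 1 / t - 2 * ln t"
  proof (rule DERIV_nonneg_imp_nondecreasing[of 1 t "\<lambda>t. t - 1 / t - 2 * ln t"])
    fix x :: real assume x: "1 \<le> x" "x \<le> t"
    have "((\<lambda>t. t - 1 / t - 2 * ln t) has_real_derivative (1 - 1 / x)\<^sup>2) (at x)"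
      using x by (auto intro!: derivative_eq_intros simp: field_simps power2_eq_square)
    then show "\<exists>y. ((\<lambda>t. t - 1 / t - 2 * ln t) has_real_derivative y) (at x) \<and> 0 \<le> y"
      by (meson zero_le_power2)
  qed (use t in simp)
  then have "2 * ln t \<le> t - 1 / t" by simp
  also have "t - 1 / t = (y - 1) / sqrt y"
    using t by (simp add: field_simps power2_eq_square)
  finally show ?thesis using t by (simp add: ln_realpow)
qed

text \<open>Mean value theorem for the sine: between the two arcsines its slope is at most the slope
  at the left one, which is \<open>sqrt (1 - a^2)\<close>. The form without division admits
  \<open>a = 1\<close>.\<close>

lemma arcsin_diff_ge:
  fixes a b :: real
  assumes "0 \<le> a" "a \<le> b" "b \<le> 1"
  shows "(b - a) \<le> sqrt (1 - a\<^sup>2) * (arcsin b - arcsin a)"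
proof (cases "a = b")
  case False
  then have lt: "arcsin a < arcsin b" using assms by (intro arcsin_less_arcsin) auto
  obtain z where z: "arcsin a < z" "z < arcsin b"
    "sin (arcsin b) - sin (arcsin a) = (arcsin b - arcsin a) * cos z"
    using MVT2[OF lt, of sin cos] by (auto intro: DERIV_sin)
  have "cos z \<le> cos (arcsin a)"
  proof (rule cos_monotone_0_pi_le)
    show "0 \<le> arcsin a" using assms arcsin_le_arcsin[of 0 a] by simp
    have "arcsin b \<le> pi / 2" using assms by (intro arcsin_ubound) auto
    then show "z \<le> pi" using z pi_gt_zero by linarith
  qed (use z in simp)
  then have "(arcsin b - arcsin a) * cos z \<le> (arcsin b - arcsin a) * cos (arcsin a)"
    using lt by (intro mult_left_mono) auto
  then show ?thesis using z(3) assms by (simp add: cos_arcsin mult.commute)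
qed simp

text \<open>A continuous antiderivative of a majorant of half the kernel
  \<open>ln ((x + r) / \<bar>x - r\<bar>) / x\<close>: the derivative is
  \<open>1 / sqrt (r^2 - x^2)\<close> below \<open>r\<close> and
  \<open>r / (x * sqrt (x^2 - r^2))\<close> above. It climbs from 0 towards \<open>pi\<close>, and
  this total rise limits what one root can contribute.\<close>

definition angle :: "real \<Rightarrow> real \<Rightarrow> real" where
  "angle r x = (if x \<le> r then arcsin (x / r) else pi - arcsin (r / x))"

lemma angle_mono:
  assumes "0 < r" "0 \<le> x" "x \<le> y"
  shows "angle r x \<le> angle r y"
proof -
  have 1: "arcsin (x / r) \<le> pi/2" if "x \<le> r"
    using that assms by (intro arcsin_ubound) (auto simp: field_simps intro: order_trans[of "-r" 0])
  have 2: "arcsin (r / y) \<le> pi/2" if "r < y"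
    using that assms by (intro arcsin_ubound) (auto simp: field_simps)
  have m1: "-1 \<le> x / r" using assms by (auto intro: order_trans[of "-1" 0])
  consider "y \<le> r" | "x \<le> r" "r < y" | "r < x" by linarith
  then show ?thesis
  proof cases
    case 1
    then show ?thesis using assms m1
      by (auto simp: angle_def divide_right_mono intro!: arcsin_le_arcsin)
  next
    case 2
    then show ?thesis using 1 \<open>r < y \<Longrightarrow> _\<close> by (auto simp: angle_def)
  next
    case 3
    have "-1 \<le> r / y" using assms by (auto intro: order_trans[of "-1" 0])
    then show ?thesis using 3 assms
      by (auto simp: angle_def frac_le intro!: arcsin_le_arcsin)
  qed
qed

lemma angle_zero [simp]: "0 < r \<Longrightarrow> angle r 0 = 0"
  by (simp add: angle_def)

lemma angle_le_pi:
  assumes "0 < r" "0 \<le> x"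
  shows "angle r x \<le> pi"
proof (cases "x \<le> r")
  case True
  have "arcsin (x / r) \<le> pi / 2"
    using True assms by (intro arcsin_ubound) (auto intro: order_trans[of "-1" 0])
  then show ?thesis using True pi_gt_zero by (simp add: angle_def del: arcsin_ubound; linarith)
next
  case False
  have "arcsin 0 \<le> arcsin (r / x)"
    using False assms by (intro arcsin_le_arcsin) auto
  then show ?thesis using False by (simp add: angle_def)
qed

text \<open>By \<open>ln_le_sqrt_diff\<close> the kernel is at most twice the slope of
  \<open>angle r\<close> at \<open>x\<close>. The slope increases up to \<open>r\<close> and
  decreases beyond it, so it is at most the increment over \<open>[x, x + 1]\<close> on the left and
  over \<open>[x - 1, x]\<close> on the right; \<open>sep\<close> keeps these intervals on one side
  of \<open>r\<close>.\<close>

lemma kernel_le_angle_diff: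
  assumes r: "0 < r" and x: "1 \<le> x" and sep: "1 \<le> \<bar>x - r\<bar>"
  shows "ln ((x + r) / \<bar>x - r\<bar>) / x \<le> 2 * (angle r (x + 1) - angle r (x - 1))"
proof (cases "x < r")
  case True
  then have xr: "x + 1 \<le> r" using sep by simp
  define s where "s = sqrt (r\<^sup>2 - x\<^sup>2)"
  have pos: "r\<^sup>2 - x\<^sup>2 > 0" using True x by (simp add: power_strict_mono)
  then have s: "s > 0" "s\<^sup>2 = r\<^sup>2 - x\<^sup>2" by (auto simp: s_def)
  have e1: "sqrt (1 - (x / r)\<^sup>2) = s / r"
    unfolding s_def using r by (simp add: power_divide real_sqrt_divide[symmetric] field_simps real_sqrt_divide)
  have "(x + 1) / r - x / r \<le> sqrt (1 - (x / r)\<^sup>2) * (arcsin ((x + 1) / r) - arcsin (x / r))"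
    using r x xr by (intro arcsin_diff_ge) (auto simp: divide_right_mono)
  then have "1 / r \<le> s / r * (angle r (x + 1) - angle r x)"
    unfolding e1 using xr by (simp add: angle_def diff_divide_distrib add_divide_distrib)
  then have A: "1 \<le> s * (angle r (x + 1) - angle r x)" using r by (simp add: field_simps)
  have y: "sqrt ((x + r) / (r - x)) = s / (r - x)"
  proof (rule real_sqrt_unique)
    show "(s / (r - x))\<^sup>2 = (x + r) / (r - x)"
    proof -
      have "s\<^sup>2 = (r - x) * (x + r)" using s by (simp add: power2_eq_square algebra_simps)
      then show ?thesis using True by (simp add: power_divide power2_eq_square)
    qed
  qed (use True s in simp)
  have "ln ((x + r) / (r - x)) \<le> ((x + r) / (r - x) - 1) / sqrt ((x + r) / (r - x))"
    using True x by (intro ln_le_sqrt_diff) (simp add: field_simps)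
  also have "\<dots> = 2 * x / s"
    unfolding y using True s by (simp add: field_simps)
  finally have "ln ((x + r) / (r - x)) / x \<le> 2 / s" using x by (simp add: field_simps)
  also have "\<dots> \<le> 2 * (angle r (x + 1) - angle r x)" using A s by (simp add: field_simps)
  also have "\<dots> \<le> 2 * (angle r (x + 1) - angle r (x - 1))"
    using angle_mono[of r "x - 1" x] r x by simp
  finally show ?thesis using True by simp
next
  case False
  then have xr: "r + 1 \<le> x" using sep by linarith
  then have x1: "1 < x" using r by simp
  define s where "s = sqrt (x\<^sup>2 - r\<^sup>2)"
  have pos: "x\<^sup>2 - r\<^sup>2 > 0" using xr r by (simp add: power_strict_mono)
  then have s: "s > 0" "s\<^sup>2 = x\<^sup>2 - r\<^sup>2" by (auto simp: s_def)
  have e1: "sqrt (1 - (r / x)\<^sup>2) = s / x"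
    unfolding s_def using x by (simp add: power_divide real_sqrt_divide[symmetric] field_simps real_sqrt_divide)
  have "r / (x - 1) - r / x \<le> sqrt (1 - (r / x)\<^sup>2) * (arcsin (r / (x - 1)) - arcsin (r / x))"
    using r x xr by (intro arcsin_diff_ge) (auto simp: field_simps)
  \<comment> \<open>At \<open>x - 1 = r\<close> the definition of \<open>angle\<close> takes its
    first branch; both branches give \<open>pi / 2\<close> there.\<close>
  also have "arcsin (r / (x - 1)) - arcsin (r / x) = angle r x - angle r (x - 1)"
    using xr r by (cases "x - 1 = r") (auto simp: angle_def)
  finally have "r / (x - 1) - r / x \<le> s / x * (angle r x - angle r (x - 1))" unfolding e1 .
  moreover have "r / (x * x) \<le> r / (x - 1) - r / x"
    using x1 r by (simp add: field_simps)
  ultimately have "r / (x * x) \<le> s / x * (angle r x - angle r (x - 1))" by linarith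
  then have A: "r / x \<le> s * (angle r x - angle r (x - 1))" using x by (simp add: field_simps)
  have y: "sqrt ((x + r) / (x - r)) = s / (x - r)"
  proof (rule real_sqrt_unique)
    show "(s / (x - r))\<^sup>2 = (x + r) / (x - r)"
    proof -
      have "s\<^sup>2 = (x - r) * (x + r)" using s by (simp add: power2_eq_square algebra_simps)
      then show ?thesis using xr by (simp add: power_divide power2_eq_square)
    qed
  qed (use xr s in simp)
  have "ln ((x + r) / (x - r)) \<le> ((x + r) / (x - r) - 1) / sqrt ((x + r) / (x - r))"
    using xr r by (intro ln_le_sqrt_diff) (simp add: field_simps)
  also have "\<dots> = 2 * r / s"
    unfolding y using xr s by (simp add: field_simps)
  finally have "ln ((x + r) / (x - r)) / x \<le> 2 * (r / x / s)" using x by (simp add: field_simps)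
  also have "r / x / s \<le> angle r x - angle r (x - 1)"
    using A s by (subst pos_divide_le_eq) (simp_all only: mult.commute)
  also have "2 * (angle r x - angle r (x - 1)) \<le> 2 * (angle r (x + 1) - angle r (x - 1))"
    using angle_mono[of r "x" "x + 1"] r x by simp
  finally show ?thesis using xr by simp
qed

text \<open>The intervals of radius 1 around the odd points meet only at their ends, so the
  increments of \<open>angle r\<close> telescope to at most \<open>pi\<close>, whatever
  \<open>r\<close> is.\<close>

lemma kernel_sum_le:
  fixes r :: real
  assumes "0 \<le> r" and S: "S \<subseteq> {..<M}"
    and sep: "\<And>j. j \<in> S \<Longrightarrow> 1 \<le> \<bar>(2 * real j + 1) - r\<bar>"
  shows "(\<Sum>j\<in>S. ln ((2 * real j + 1 + r) / \<bar>2 * real j + 1 - r\<bar>) / (2 * real j + 1)) \<le> 2 * pi"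
proof (cases "r = 0")
  case True
  have "ln ((2 * real j + 1 + r) / \<bar>2 * real j + 1 - r\<bar>) = 0" for j
    using True by simp
  then show ?thesis by simp
next
  case False
  then have r: "0 < r" using assms by simp
  let ?d = "\<lambda>j. 2 * (angle r (2 * real (Suc j)) - angle r (2 * real j))"
  have "(\<Sum>j\<in>S. ln ((2 * real j + 1 + r) / \<bar>2 * real j + 1 - r\<bar>) / (2 * real j + 1)) \<le> (\<Sum>j\<in>S. ?d j)"
  proof (rule sum_mono)
    fix j assume "j \<in> S"
    from kernel_le_angle_diff[OF r _ sep[OF this]]
    show "ln ((2 * real j + 1 + r) / \<bar>2 * real j + 1 - r\<bar>) / (2 * real j + 1) \<le> ?d j"
      by (simp add: algebra_simps)
  qed
  also have "\<dots> \<le> (\<Sum>j<M. ?d j)"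
    using S r by (intro sum_mono2) (auto intro!: angle_mono)
  also have "\<dots> = 2 * (angle r (2 * real M) - angle r (2 * real 0))"
    unfolding sum_distrib_left[symmetric]
    using sum_lessThan_telescope[of "\<lambda>j. angle r (2 * real j)" M] by simp
  also have "\<dots> \<le> 2 * pi" using angle_le_pi[of r "2 * real M"] r by simp
  finally show ?thesis .
qed

text \<open>The terms from index \<open>N\<close> on dominate a telescoping logarithm. At most
  \<open>N\<close> of them are missing, each at most \<open>1 / (2 N + 1)\<close>, which costs at
  most 1/2.\<close>

lemma sum_odd_reciprocals_ge:
  assumes S: "S \<subseteq> {..<M}" and card: "card ({..<M} - S) \<le> N" and "N \<le> M"
  shows "(ln ((2 * real M + 1) / (2 * real N + 1)) - 1) / 2 \<le> (\<Sum>j\<in>S. 1 / (2 * real j + 1))"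
proof -
  have step: "(ln (2 * real (Suc j) + 1) - ln (2 * real j + 1)) / 2 \<le> 1 / (2 * real j + 1)" for j
  proof -
    have "ln (2 * real (Suc j) + 1) - ln (2 * real j + 1) = ln (1 + 2 / (2 * real j + 1))"
      using ln_div[of "2 * real (Suc j) + 1" "2 * real j + 1"] by (simp add: field_simps)
    also have "\<dots> \<le> 2 / (2 * real j + 1)" by (rule ln_add_one_self_le_self) simp
    finally show ?thesis by simp
  qed
  have "ln ((2 * real M + 1) / (2 * real N + 1)) / 2
      = (\<Sum>j=N..<M. (ln (2 * real (Suc j) + 1) - ln (2 * real j + 1)) / 2)"
    unfolding sum_divide_distrib[symmetric]
    using sum_Suc_diff'[of N M "\<lambda>j. ln (2 * real j + 1)"] \<open>N \<le> M\<close> by (simp add: ln_div)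
  also have "\<dots> \<le> (\<Sum>j=N..<M. 1 / (2 * real j + 1))" by (intro sum_mono step)
  also have "\<dots> = (\<Sum>j\<in>{N..<M} \<inter> S. 1 / (2 * real j + 1)) + (\<Sum>j\<in>{N..<M} - S. 1 / (2 * real j + 1))"
    by (rule sum.Int_Diff) simp
  also have "(\<Sum>j\<in>{N..<M} - S. 1 / (2 * real j + 1)) \<le> (\<Sum>j\<in>{N..<M} - S. 1 / (2 * real N + 1))"
    by (intro sum_mono) (auto intro!: divide_left_mono)
  also have "\<dots> \<le> real N * (1 / (2 * real N + 1))"
  proof -
    have "card ({N..<M} - S) \<le> card ({..<M} - S)" by (intro card_mono) auto
    then show ?thesis using card by (simp add: divide_right_mono)
  qed
  also have "\<dots> \<le> 1 / 2" by (simp add: field_simps)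
  also have "(\<Sum>j\<in>{N..<M} \<inter> S. 1 / (2 * real j + 1)) \<le> (\<Sum>j\<in>S. 1 / (2 * real j + 1))"
    using S finite_subset[OF S] by (intro sum_mono2) auto
  finally show ?thesis by simp
qed

section \<open>Roots and the reflection of the line at the origin\<close>

lemma complex_poly_root_product:
  fixes W :: "real poly"
  assumes "W \<noteq> 0"
  obtains w :: "nat \<Rightarrow> complex" where
    "\<And>x. \<bar>poly W x\<bar> = \<bar>lead_coeff W\<bar> * (\<Prod>i<degree W. cmod (of_real x - w i))"
proof -
  let ?W = "map_poly of_real W :: complex poly"
  have W: "?W \<noteq> 0" using assms by (simp add: map_poly_eq_0_iff)
  have d: "degree ?W = degree W" by (simp add: degree_map_poly)
  have lc: "lead_coeff ?W = of_real (lead_coeff W)" by (simp add: coeff_map_poly degree_map_poly)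
  obtain A where A: "size A = degree ?W" "?W = smult (lead_coeff ?W) (\<Prod>x\<in>#A. [:-x, 1:])"
    using alg_closed_imp_factorization[OF W] by blast
  obtain ws where ws: "mset ws = A" by (meson ex_mset)
  have "\<bar>poly W x\<bar> = \<bar>lead_coeff W\<bar> * (\<Prod>i<degree W. cmod (of_real x - ws ! i))" for x
  proof -
    have len: "length ws = degree W" using A(1) ws d by (metis size_mset)
    have "poly ?W (of_real x) = of_real (poly W x)"
      by (induction W) (auto simp: map_poly_pCons)
    then have "\<bar>poly W x\<bar> = cmod (poly ?W (of_real x))" by simp
    also have "poly ?W (of_real x) = of_real (lead_coeff W) * (\<Prod>w\<leftarrow>ws. of_real x - w)"
      by (subst A(2)) (simp add: lc ws[symmetric] poly_prod_mset prod_mset_prod_list[symmetric] del: prod_mset_prod_list)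
    also have "cmod \<dots> = \<bar>lead_coeff W\<bar> * cmod (\<Prod>w\<leftarrow>ws. of_real x - w)"
      by (simp add: norm_mult)
    also have "(\<Prod>w\<leftarrow>ws. of_real x - w) = (\<Prod>i<degree W. of_real x - ws ! i)"
      unfolding prod.list_conv_set_nth len[symmetric] by (simp add: atLeast0LessThan)
    finally show ?thesis by (simp add: prod_norm)
  qed
  then show ?thesis by (rule that)
qed

text \<open>After squaring, the claim reduces to \<open>Re w <= cmod w\<close>. Among the roots of a
  given modulus the positive real one thus makes the ratio of the distances from \<open>x\<close>
  and from \<open>- x\<close> smallest, so only the moduli of the roots matter.\<close>

lemma cmod_reflection_ge:
  fixes x :: real and w :: complex
  assumes "0 \<le> x"
  shows "cmod (of_real x + w) * \<bar>x - cmod w\<bar> \<le> cmod (of_real x - w) * (x + cmod w)"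
proof (rule power2_le_imp_le)
  define a where "a = x\<^sup>2 + (cmod w)\<^sup>2"
  define b where "b = 2 * x * Re w"
  define c where "c = 2 * x * cmod w"
  have 1: "(cmod (of_real x + w))\<^sup>2 = a + b" "(cmod (of_real x - w))\<^sup>2 = a - b"
    unfolding a_def b_def cmod_power2 by (simp_all add: power2_eq_square algebra_simps)
  have 2: "\<bar>x - cmod w\<bar>\<^sup>2 = a - c" "(x + cmod w)\<^sup>2 = a + c"
    by (simp_all add: a_def c_def power2_eq_square algebra_simps)
  have "b \<le> c" using complex_Re_le_cmod[of w] assms by (simp add: b_def c_def mult_left_mono)
  moreover have "0 \<le> a" by (simp add: a_def)
  ultimately have "a * b \<le> a * c" by (simp add: mult_left_mono)
  then show "(cmod (of_real x + w) * \<bar>x - cmod w\<bar>)\<^sup>2 \<le> (cmod (of_real x - w) * (x + cmod w))\<^sup>2"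
    unfolding power_mult_distrib 1 2 by (simp add: algebra_simps)
qed (use assms in simp)

text \<open>Double counting over points and roots: each retained point demands
  \<open>2 ln (1 / \<rho>)\<close> from the kernels of the roots, while with the weights
  \<open>1 / x\<close> each root supplies at most \<open>2 pi\<close> altogether. The subtracted 1
  is the loss in \<open>sum_odd_reciprocals_ge\<close>.\<close>

lemma degree_ge_of_reflection_decay:
  fixes W :: "real poly" and \<rho> :: real
  assumes deg: "degree W \<le> N" and \<rho>: "0 < \<rho>" "\<rho> < 1" and "1 \<le> M"
    and nz: "\<And>j. j < M \<Longrightarrow> poly W (- (2 * real j + 1)) \<noteq> 0"
    and dec: "\<And>j. j < M \<Longrightarrow> \<bar>poly W (2 * real j + 1)\<bar> \<le> \<rho>\<^sup>2 * \<bar>poly W (- (2 * real j + 1))\<bar>"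
  shows "ln (1 / \<rho>) * (ln ((2 * real M + 1) / (2 * real N + 1)) - 1) \<le> 2 * pi * real N"
proof (cases "N \<le> M")
  case False
  then have "ln ((2 * real M + 1) / (2 * real N + 1)) \<le> 0" by simp
  then have "ln (1 / \<rho>) * (ln ((2 * real M + 1) / (2 * real N + 1)) - 1) \<le> 0"
    using \<rho> by (intro mult_nonneg_nonpos, simp, linarith)
  also have "0 \<le> 2 * pi * real N" by simp
  finally show ?thesis .
next
  case True
  have "W \<noteq> 0" using nz[of 0] \<open>1 \<le> M\<close> by auto
  then obtain w :: "nat \<Rightarrow> complex" where
    w: "\<And>x. \<bar>poly W x\<bar> = \<bar>lead_coeff W\<bar> * (\<Prod>i<degree W. cmod (of_real x - w i))"
    using complex_poly_root_product by blast
  define S where "S = {j\<in>{..<M}. \<forall>i<degree W. 1 \<le> \<bar>(2 * real j + 1) - cmod (w i)\<bar>}"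
  define K where "K i j = ln ((2 * real j + 1 + cmod (w i)) / \<bar>2 * real j + 1 - cmod (w i)\<bar>)" for i j
  have S: "S \<subseteq> {..<M}" by (auto simp: S_def)
  have "card ({..<M} - S) \<le> card {..<degree W}"
  \<comment> \<open>Each omitted point is charged to a root whose modulus is at distance less than
    1. Distinct odd numbers are at least 2 apart, so no root is charged twice.\<close>
  proof (rule card_inj_on_le[where f = "\<lambda>j. SOME i. i < degree W \<and> \<bar>(2 * real j + 1) - cmod (w i)\<bar> < 1"])
    have ex: "\<exists>i. i < degree W \<and> \<bar>(2 * real j + 1) - cmod (w i)\<bar> < 1" if "j \<in> {..<M} - S" for j
      using that by (auto simp: S_def not_le)
    note P = someI_ex[OF ex]
    show "(\<lambda>j. SOME i. i < degree W \<and> \<bar>(2 * real j + 1) - cmod (w i)\<bar> < 1) ` ({..<M} - S) \<subseteq> {..<degree W}"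
      using P by blast
    show "inj_on (\<lambda>j. SOME i. i < degree W \<and> \<bar>(2 * real j + 1) - cmod (w i)\<bar> < 1) ({..<M} - S)"
    proof (rule inj_onI)
      fix j k assume jk: "j \<in> {..<M} - S" "k \<in> {..<M} - S"
        and "(SOME i. i < degree W \<and> \<bar>(2 * real j + 1) - cmod (w i)\<bar> < 1)
           = (SOME i. i < degree W \<and> \<bar>(2 * real k + 1) - cmod (w i)\<bar> < 1)"
      then obtain i where "\<bar>(2 * real j + 1) - cmod (w i)\<bar> < 1" "\<bar>(2 * real k + 1) - cmod (w i)\<bar> < 1"
        using P[OF jk(1)] P[OF jk(2)] by metis
      then have "\<bar>real j - real k\<bar> < 1" by linarith
      then show "j = k" by linarith
    qed
  qed simp
  then have card: "card ({..<M} - S) \<le> N" using deg by simp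
  have main: "2 * ln (1 / \<rho>) \<le> (\<Sum>i<degree W. K i j)" if "j \<in> S" for j
  proof -
    define x where "x = 2 * real j + 1"
    have x: "0 < x" by (simp add: x_def)
    have jM: "j < M" and sep: "\<And>i. i < degree W \<Longrightarrow> 0 < \<bar>x - cmod (w i)\<bar>"
      using that by (force simp: S_def x_def)+
    let ?m = "\<Prod>i<degree W. cmod (of_real x - w i)"
    let ?p = "\<Prod>i<degree W. cmod (of_real x + w i)"
    let ?a = "\<Prod>i<degree W. \<bar>x - cmod (w i)\<bar>"
    let ?b = "\<Prod>i<degree W. x + cmod (w i)"
    have neg: "cmod (of_real (- x) - w i) = cmod (of_real x + w i)" for i
      using norm_minus_cancel[of "of_real x + w i"] by (simp add: algebra_simps)
    have pW: "\<bar>poly W (- x)\<bar> = \<bar>lead_coeff W\<bar> * ?p" unfolding w neg ..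
    have "\<bar>lead_coeff W\<bar> * ?m \<le> \<rho>\<^sup>2 * (\<bar>lead_coeff W\<bar> * ?p)"
      using dec[OF jM] unfolding x_def[symmetric] pW w[of x] .
    then have mp: "?m \<le> \<rho>\<^sup>2 * ?p" using \<open>W \<noteq> 0\<close> by (simp add: mult.left_commute)
    have p: "0 < ?p"
    proof -
      have "?p \<noteq> 0"
      proof
        assume "?p = 0"
        then have "\<bar>poly W (- x)\<bar> = 0" unfolding pW by (simp only: mult_zero_right)
        then show False using nz[OF jM] unfolding x_def[symmetric] by simp
      qed
      moreover have "0 \<le> ?p" by (intro prod_nonneg) auto
      ultimately show ?thesis by linarith
    qed
    have a: "0 < ?a" using sep by (intro prod_pos) auto
    have b: "0 < ?b" using x by (intro prod_pos) (auto simp: add_pos_nonneg)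
    \<comment> \<open>The reflection inequality, multiplied over all roots; together with the decay
      \<open>mp\<close> it leaves a comparison of moduli alone.\<close>
    have "?p * ?a \<le> ?m * ?b"
      unfolding prod.distrib[symmetric] using x cmod_reflection_ge[of x]
      by (intro prod_mono) auto
    also have "\<dots> \<le> (\<rho>\<^sup>2 * ?p) * ?b" using mp b by (intro mult_right_mono) auto
    finally have "?a \<le> \<rho>\<^sup>2 * ?b" using p by (simp add: mult.assoc mult.left_commute)
    then have "(1 / \<rho>)\<^sup>2 \<le> ?b / ?a" using a \<rho> by (simp add: field_simps)
    then have "ln ((1 / \<rho>)\<^sup>2) \<le> ln (?b / ?a)" using \<rho> a b by (subst ln_le_cancel_iff) auto
    also have "ln (?b / ?a) = ln (\<Prod>i<degree W. (x + cmod (w i)) / \<bar>x - cmod (w i)\<bar>)"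
      by (simp add: prod_dividef)
    also have "\<dots> = (\<Sum>i<degree W. K i j)"
      unfolding K_def x_def[symmetric]
    proof (rule ln_prod)
      fix i assume "i \<in> {..<degree W}"
      then have "0 < (x + cmod (w i)) / \<bar>x - cmod (w i)\<bar>"
        using sep x by (intro divide_pos_pos add_pos_nonneg) auto
      then show "(x + cmod (w i)) / \<bar>x - cmod (w i)\<bar> \<noteq> 0" by linarith
    qed simp
    finally show ?thesis using \<rho> by (simp add: ln_realpow)
  qed
  have "ln (1 / \<rho>) * (ln ((2 * real M + 1) / (2 * real N + 1)) - 1)
      = 2 * ln (1 / \<rho>) * ((ln ((2 * real M + 1) / (2 * real N + 1)) - 1) / 2)" by simp
  also have "\<dots> \<le> 2 * ln (1 / \<rho>) * (\<Sum>j\<in>S. 1 / (2 * real j + 1))"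
    using \<rho> by (intro mult_left_mono[OF sum_odd_reciprocals_ge[OF S card True]]) auto
  also have "\<dots> = (\<Sum>j\<in>S. 2 * ln (1 / \<rho>) / (2 * real j + 1))" by (simp add: sum_distrib_left)
  also have "\<dots> \<le> (\<Sum>j\<in>S. (\<Sum>i<degree W. K i j) / (2 * real j + 1))"
    by (intro sum_mono divide_right_mono main) auto
  also have "\<dots> = (\<Sum>i<degree W. \<Sum>j\<in>S. K i j / (2 * real j + 1))"
    by (simp add: sum_divide_distrib) (rule sum.swap)
  also have "\<dots> \<le> (\<Sum>i<degree W. 2 * pi)"
    unfolding K_def using S by (intro sum_mono kernel_sum_le) (auto simp: S_def)
  also have "\<dots> \<le> 2 * pi * real N" using deg by simp
  finally show ?thesis .
qed

text \<open>The product \<open>U(x) V(-x)\<close> joins one factor \<open>\<rho>\<close> from each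
  side of the origin into the \<open>\<rho>^2\<close> of the decay lemma. Its degree is up to
  \<open>2 D\<close>, whence the constants 4.\<close>

lemma degree_ge_of_sign_separation:
  fixes U V :: "real poly"
  assumes deg: "degree U \<le> D" "degree V \<le> D" and \<rho>: "0 < \<rho>" "\<rho> < 1" and "1 \<le> M"
    and pos: "\<And>j. j < M \<Longrightarrow> poly V (2 * real j + 1) \<noteq> 0 \<and>
                \<bar>poly U (2 * real j + 1)\<bar> \<le> \<rho> * \<bar>poly V (2 * real j + 1)\<bar>"
    and neg: "\<And>j. j < M \<Longrightarrow> poly U (- (2 * real j + 1)) \<noteq> 0 \<and>
                \<bar>poly V (- (2 * real j + 1))\<bar> \<le> \<rho> * \<bar>poly U (- (2 * real j + 1))\<bar>"
  shows "ln (1 / \<rho>) * (ln ((2 * real M + 1) / (4 * real D + 1)) - 1) \<le> 4 * pi * real D"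
proof -
  define W where "W = U * (V \<circ>\<^sub>p [:0, -1:])"
  have W: "poly W x = poly U x * poly V (- x)" for x by (simp add: W_def poly_pcompose)
  have "degree W \<le> degree U + degree (V \<circ>\<^sub>p [:0, -1:])" unfolding W_def by (rule degree_mult_le)
  also have "\<dots> \<le> 2 * D" using deg by (simp add: degree_pcompose)
  finally have dW: "degree W \<le> 2 * D" .
  have "ln (1 / \<rho>) * (ln ((2 * real M + 1) / (2 * real (2 * D) + 1)) - 1) \<le> 2 * pi * real (2 * D)"
  proof (rule degree_ge_of_reflection_decay[OF dW \<rho> \<open>1 \<le> M\<close>])
    fix j assume j: "j < M"
    show "poly W (- (2 * real j + 1)) \<noteq> 0"
      using pos[OF j] neg[OF j] by (simp add: W add.commute)
    have "\<bar>poly U (2 * real j + 1)\<bar> * \<bar>poly V (- (2 * real j + 1))\<bar>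
        \<le> (\<rho> * \<bar>poly V (2 * real j + 1)\<bar>) * (\<rho> * \<bar>poly U (- (2 * real j + 1))\<bar>)"
      using pos[OF j] neg[OF j] \<rho> by (intro mult_mono) auto
    then show "\<bar>poly W (2 * real j + 1)\<bar> \<le> \<rho>\<^sup>2 * \<bar>poly W (- (2 * real j + 1))\<bar>"
      unfolding W abs_mult minus_minus by (simp add: power2_eq_square mult_ac)
  qed
  then show ?thesis by simp
qed

section \<open>Polynomials on the cube and their symmetrization\<close>

text \<open>Polynomials of degree at most \<open>d\<close>, represented by the functions that they
  induce on the cube and generated by the multilinear monomials. The rule \<open>cong\<close>
  disregards values off the cube, where squares of coordinates need not be 1.\<close>

inductive cube_span :: "nat \<Rightarrow> nat \<Rightarrow> ((nat \<Rightarrow> real) \<Rightarrow> real) \<Rightarrow> bool" for n d where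
  char: "S \<subseteq> {..<n} \<Longrightarrow> card S \<le> d \<Longrightarrow> cube_span n d (\<lambda>z. \<Prod>i\<in>S. z i)"
| scale: "cube_span n d f \<Longrightarrow> cube_span n d (\<lambda>z. c * f z)"
| add: "cube_span n d f \<Longrightarrow> cube_span n d g \<Longrightarrow> cube_span n d (\<lambda>z. f z + g z)"
| cong: "cube_span n d f \<Longrightarrow> (\<And>z. z \<in> cube n \<Longrightarrow> f z = g z) \<Longrightarrow> cube_span n d g"

lemma cube_coordinate: "z \<in> cube n \<Longrightarrow> i < n \<Longrightarrow> z i = 1 \<or> z i = -1"
  by (auto simp: cube_def PiE_def Pi_def)

lemma finite_cube [simp]: "finite (cube n)"
  by (simp add: cube_def finite_PiE)

lemma cube_span_mono: "cube_span n d f \<Longrightarrow> d \<le> e \<Longrightarrow> cube_span n e f"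
proof (induction rule: cube_span.induct)
  case (char S)
  then show ?case by (intro cube_span.char) auto
next
  case (cong f g)
  then show ?case using cube_span.cong[of n e f g] by blast
qed (auto intro: cube_span.scale cube_span.add)

lemma cube_span_const: "cube_span n d (\<lambda>z. c)"
  using cube_span.scale[OF cube_span.char[of "{}"], of n d c] by simp

lemma cube_span_var: "i < n \<Longrightarrow> cube_span n 1 (\<lambda>z. z i)"
  using cube_span.char[of "{i}" n 1] by simp

text \<open>By bilinearity, nested inductions reduce this to two characters. On the cube shared
  variables square to 1, so their product is the character of the symmetric difference.\<close>

lemma cube_span_mult:
  assumes "cube_span n d f" "cube_span n e g"
  shows "cube_span n (d + e) (\<lambda>z. f z * g z)"
  using assms(1)
proof (induction rule: cube_span.induct)
  case (char S)
  show ?case using assms(2)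
  proof (induction rule: cube_span.induct)
    case (char T)
    have fin: "finite S" "finite T" using \<open>S \<subseteq> _\<close> \<open>T \<subseteq> _\<close> by (auto intro: finite_subset)
    let ?D = "(S - T) \<union> (T - S)"
    have "card ?D \<le> card (S - T) + card (T - S)" by (rule card_Un_le)
    also have "\<dots> \<le> card S + card T"
      using fin by (intro add_mono card_mono) auto
    finally have card: "card ?D \<le> d + e" using \<open>card S \<le> d\<close> \<open>card T \<le> e\<close> by simp
    have "cube_span n (d + e) (\<lambda>z. \<Prod>i\<in>?D. z i)"
      using \<open>S \<subseteq> _\<close> \<open>T \<subseteq> _\<close> card by (intro cube_span.char) auto
    then show ?case
    proof (rule cube_span.cong)
      fix z assume z: "z \<in> cube n"
      have sq: "(\<Prod>i\<in>S \<inter> T. z i) * (\<Prod>i\<in>S \<inter> T. z i) = 1"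
        unfolding prod.distrib[symmetric]
        using cube_coordinate[OF z] \<open>S \<subseteq> _\<close> by (intro prod.neutral) force
      have "(\<Prod>i\<in>S. z i) * (\<Prod>i\<in>T. z i)
          = ((\<Prod>i\<in>S \<inter> T. z i) * (\<Prod>i\<in>S - T. z i)) * ((\<Prod>i\<in>S \<inter> T. z i) * (\<Prod>i\<in>T - S. z i))"
        using prod.Int_Diff[OF fin(1), of z T] prod.Int_Diff[OF fin(2), of z S] by (simp add: Int_commute)
      also have "\<dots> = ((\<Prod>i\<in>S \<inter> T. z i) * (\<Prod>i\<in>S \<inter> T. z i)) * ((\<Prod>i\<in>S - T. z i) * (\<Prod>i\<in>T - S. z i))"
        by (simp only: mult_ac)
      also have "\<dots> = (\<Prod>i\<in>?D. z i)"
        using fin by (subst prod.union_disjoint) (auto simp: sq)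
      finally show "(\<Prod>i\<in>?D. z i) = (\<Prod>i\<in>S. z i) * (\<Prod>i\<in>T. z i)" ..
    qed
  next
    case (scale g c)
    then show ?case using cube_span.scale[OF scale.IH, of c] by (simp add: mult_ac)
  next
    case (add g h)
    then show ?case using cube_span.add[OF add.IH] by (simp add: algebra_simps)
  next
    case (cong g h)
    show ?case by (rule cube_span.cong[OF cong.IH]) (simp add: cong.hyps)
  qed
next
  case (scale f c)
  then show ?case using cube_span.scale[OF scale.IH, of c] by (simp add: mult_ac)
next
  case (add f h)
  then show ?case using cube_span.add[OF add.IH] by (simp add: algebra_simps)
next
  case (cong f h)
  show ?case by (rule cube_span.cong[OF cong.IH]) (simp add: cong.hyps)
qed

lemma cube_span_diff:
  assumes "cube_span n d f" "cube_span n d g"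
  shows "cube_span n d (\<lambda>z. f z - g z)"
  using cube_span.add[OF assms(1) cube_span.scale[OF assms(2), of "-1"]] by simp

lemma cube_span_sum:
  assumes "finite I" "\<And>i. i \<in> I \<Longrightarrow> cube_span n d (f i)"
  shows "cube_span n d (\<lambda>z. \<Sum>i\<in>I. f i z)"
  using assms by (induction) (auto intro: cube_span.add cube_span_const)

lemma cube_span_prod:
  assumes "finite I" "\<And>i. i \<in> I \<Longrightarrow> cube_span n (e i) (f i)"
  shows "cube_span n (\<Sum>i\<in>I. e i) (\<lambda>z. \<Prod>i\<in>I. f i z)"
  using assms by (induction) (auto intro: cube_span_mult cube_span_const)

lemma cube_span_power:
  assumes "cube_span n 1 f"
  shows "cube_span n k (\<lambda>z. f z ^ k)"
proof (induction k)
  case (Suc k)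
  then show ?case using cube_span_mult[OF assms Suc] by simp
qed (simp add: cube_span_const)

section \<open>Formal polynomials and the rational degree\<close>

lemma total_degree_le_iff:
  "total_degree p \<le> d \<longleftrightarrow> (\<forall>m\<in>Poly_Mapping.keys p. monom_degree m \<le> d)"
  unfolding total_degree_def by (subst Max_le_iff) auto

lemma cube_span_mpoly_eval:
  assumes "mpoly_in_vars n p" "total_degree p \<le> d"
  shows "cube_span n d (mpoly_eval p)"
proof -
  have "cube_span n d (\<lambda>z. Poly_Mapping.lookup p m *
      (\<Prod>i\<in>Poly_Mapping.keys m. z i ^ Poly_Mapping.lookup m i))" if m: "m \<in> Poly_Mapping.keys p" for m
  proof (rule cube_span.scale, rule cube_span_mono)
    show "cube_span n (monom_degree m) (\<lambda>z. \<Prod>i\<in>Poly_Mapping.keys m. z i ^ Poly_Mapping.lookup m i)"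
      unfolding monom_degree_def
    proof (rule cube_span_prod)
      fix i assume "i \<in> Poly_Mapping.keys m"
      then have "i < n" using m assms(1) by (auto simp: mpoly_in_vars_def)
      then show "cube_span n (Poly_Mapping.lookup m i) (\<lambda>z. z i ^ Poly_Mapping.lookup m i)"
        by (rule cube_span_power[OF cube_span_var])
    qed simp
    show "monom_degree m \<le> d" using m assms(2) by (simp add: total_degree_le_iff)
  qed
  then show ?thesis unfolding mpoly_eval_def[abs_def] by (rule cube_span_sum[OF finite_keys])
qed

text \<open>Sums and multiples can lose monomials by cancellation; evaluations are therefore
  compared over a common superset of the key sets.\<close>

lemma mpoly_eval_superset:
  assumes "finite K" "Poly_Mapping.keys p \<subseteq> K"
  shows "mpoly_eval p x =
    (\<Sum>m\<in>K. Poly_Mapping.lookup p m * (\<Prod>i\<in>Poly_Mapping.keys m. x i ^ Poly_Mapping.lookup m i))"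
  unfolding mpoly_eval_def using assms
  by (intro sum.mono_neutral_left) (auto simp: in_keys_iff)

lemma cube_span_imp_mpoly:
  assumes "cube_span n d f"
  obtains p where "mpoly_in_vars n p" "total_degree p \<le> d" "\<And>z. z \<in> cube n \<Longrightarrow> mpoly_eval p z = f z"
proof -
  from assms have "\<exists>p. mpoly_in_vars n p \<and> total_degree p \<le> d \<and> (\<forall>z\<in>cube n. mpoly_eval p z = f z)"
  proof (induction rule: cube_span.induct)
    case (char S)
    then have fin: "finite S" by (auto intro: finite_subset)
    \<comment> \<open>The exponent vector of the squarefree monomial with variable set
      \<open>S\<close>.\<close>
    define m where "m = Abs_poly_mapping (\<lambda>i. if i \<in> S then 1 else 0 :: nat)"
    have lk: "Poly_Mapping.lookup m = (\<lambda>i. if i \<in> S then 1 else 0)"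
      unfolding m_def using fin by (subst lookup_Abs_poly_mapping) auto
    have ky: "Poly_Mapping.keys m = S" by (auto simp: in_keys_iff lk split: if_splits)
    have "monom_degree m = card S" by (simp add: monom_degree_def ky lk)
    then show ?case using char
      by (intro exI[of _ "Poly_Mapping.single m 1"])
        (auto simp: mpoly_in_vars_def total_degree_le_iff mpoly_eval_def ky lk)
  next
    case (scale f c)
    then obtain p where p: "mpoly_in_vars n p" "total_degree p \<le> d" "\<And>z. z \<in> cube n \<Longrightarrow> mpoly_eval p z = f z"
      by blast
    let ?q = "Poly_Mapping.map ((*) c) p"
    have lk: "Poly_Mapping.lookup ?q m = c * Poly_Mapping.lookup p m" for m
      by (simp add: Poly_Mapping.map.rep_eq when_def)
    then have ky: "Poly_Mapping.keys ?q \<subseteq> Poly_Mapping.keys p" by (auto simp: in_keys_iff)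
    have "mpoly_eval ?q z = c * mpoly_eval p z" for z
      unfolding mpoly_eval_superset[OF finite_keys ky] lk
      unfolding mpoly_eval_def by (simp add: sum_distrib_left mult.assoc)
    then show ?case using p ky
      by (intro exI[of _ ?q]) (auto simp: mpoly_in_vars_def total_degree_le_iff)
  next
    case (add f g)
    then obtain p q where p: "mpoly_in_vars n p" "total_degree p \<le> d" "\<And>z. z \<in> cube n \<Longrightarrow> mpoly_eval p z = f z"
      and q: "mpoly_in_vars n q" "total_degree q \<le> d" "\<And>z. z \<in> cube n \<Longrightarrow> mpoly_eval q z = g z"
      by metis
    let ?K = "Poly_Mapping.keys p \<union> Poly_Mapping.keys q"
    have ky: "Poly_Mapping.keys (p + q) \<subseteq> ?K" by (rule keys_add)
    have "mpoly_eval (p + q) z = mpoly_eval p z + mpoly_eval q z" for z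
      using ky by (subst (1 2 3) mpoly_eval_superset[of ?K])
        (auto simp: lookup_add sum.distrib distrib_right)
    moreover have "mpoly_in_vars n (p + q)" "total_degree (p + q) \<le> d"
      using p(1,2) q(1,2) ky unfolding mpoly_in_vars_def total_degree_le_iff by blast+
    ultimately show ?case using p(3) q(3) by (intro exI[of _ "p + q"]) simp
  next
    case (cong f g)
    then show ?case by auto
  qed
  then show ?thesis using that by blast
qed

lemma rdeg_le:
  assumes "cube_span n d f" "cube_span n d g" "\<And>z. z \<in> cube n \<Longrightarrow> g z \<noteq> 0"
    and "\<And>z. z \<in> cube n \<Longrightarrow> \<bar>h z - f z / g z\<bar> \<le> \<epsilon>"
  shows "rdeg n (cube n) \<epsilon> h \<le> d"
proof -
  obtain p where p: "mpoly_in_vars n p" "total_degree p \<le> d" "\<And>z. z \<in> cube n \<Longrightarrow> mpoly_eval p z = f z"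
    using cube_span_imp_mpoly[OF assms(1)] by blast
  obtain q where q: "mpoly_in_vars n q" "total_degree q \<le> d" "\<And>z. z \<in> cube n \<Longrightarrow> mpoly_eval q z = g z"
    using cube_span_imp_mpoly[OF assms(2)] by blast
  have "rdeg n (cube n) \<epsilon> h \<le> max (total_degree p) (total_degree q)"
    unfolding rdeg_def using p q assms(3,4)
    by (intro Least_le exI[of _ p] exI[of _ q]) auto
  then show ?thesis using p(2) q(2) by simp
qed

text \<open>The minimum in \<open>rdeg\<close> is attained once some degree qualifies; the
  approximant \<open>f / g\<close>, of whatever degree, guarantees this.\<close>

lemma rdeg_witness:
  assumes "cube_span n d f" "cube_span n d g" "\<And>z. z \<in> cube n \<Longrightarrow> g z \<noteq> 0"
    and "\<And>z. z \<in> cube n \<Longrightarrow> \<bar>h z - f z / g z\<bar> \<le> \<epsilon>"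
  obtains p q where "cube_span n (rdeg n (cube n) \<epsilon> h) p" "cube_span n (rdeg n (cube n) \<epsilon> h) q"
    "\<And>z. z \<in> cube n \<Longrightarrow> q z \<noteq> 0" "\<And>z. z \<in> cube n \<Longrightarrow> \<bar>h z - p z / q z\<bar> \<le> \<epsilon>"
proof -
  let ?P = "\<lambda>d. \<exists>p q. mpoly_in_vars n p \<and> mpoly_in_vars n q \<and>
        d = max (total_degree p) (total_degree q) \<and>
        (\<forall>z\<in>cube n. mpoly_eval q z \<noteq> 0) \<and>
        (\<forall>z\<in>cube n. \<bar>h z - mpoly_eval p z / mpoly_eval q z\<bar> \<le> \<epsilon>)"
  obtain p where p: "mpoly_in_vars n p" "total_degree p \<le> d" "\<And>z. z \<in> cube n \<Longrightarrow> mpoly_eval p z = f z"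
    using cube_span_imp_mpoly[OF assms(1)] by blast
  obtain q where q: "mpoly_in_vars n q" "total_degree q \<le> d" "\<And>z. z \<in> cube n \<Longrightarrow> mpoly_eval q z = g z"
    using cube_span_imp_mpoly[OF assms(2)] by blast
  have "?P (max (total_degree p) (total_degree q))"
    using p q assms(3,4) by (intro exI[of _ p] exI[of _ q]) auto
  then have "?P (LEAST d. ?P d)" by (rule LeastI)
  then obtain p q where pq: "mpoly_in_vars n p" "mpoly_in_vars n q"
        "rdeg n (cube n) \<epsilon> h = max (total_degree p) (total_degree q)"
        "\<forall>z\<in>cube n. mpoly_eval q z \<noteq> 0"
        "\<forall>z\<in>cube n. \<bar>h z - mpoly_eval p z / mpoly_eval q z\<bar> \<le> \<epsilon>"
    unfolding rdeg_def by blast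
  show ?thesis
    by (rule that[of "mpoly_eval p" "mpoly_eval q"])
      (use pq in \<open>auto intro!: cube_span_mpoly_eval\<close>)
qed

section \<open>Averaging over the layers of the cube\<close>

definition layer :: "nat \<Rightarrow> nat \<Rightarrow> (nat \<Rightarrow> real) set" where
  "layer n k = {z \<in> cube n. card {i\<in>{..<n}. z i = 1} = k}"

lemma finite_layer [simp]: "finite (layer n k)"
  by (simp add: layer_def)

text \<open>A point is determined by its positive coordinates outside \<open>T\<close>, of which
  there are \<open>k - card T\<close>. The case distinction guards against truncated
  subtraction.\<close>

lemma card_layer_superset:
  assumes T: "T \<subseteq> {..<n}"
  shows "card {z \<in> layer n k. \<forall>i\<in>T. z i = 1} =
    (if card T \<le> k then (n - card T) choose (k - card T) else 0)"
proof -
  have fin: "finite T" using T by (auto intro: finite_subset)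
  show ?thesis
  proof (cases "card T \<le> k")
    case False
    have "card T \<le> k" if "z \<in> layer n k" "\<forall>i\<in>T. z i = 1" for z
    proof -
      have "card T \<le> card {i\<in>{..<n}. z i = 1}" using that T by (intro card_mono) auto
      then show ?thesis using that by (simp add: layer_def)
    qed
    then have "{z \<in> layer n k. \<forall>i\<in>T. z i = 1} = {}" using False by blast
    then show ?thesis using False by simp
  next
    case True
    let ?B = "{B. B \<subseteq> {..<n} - T \<and> card B = k - card T}"
    \<comment> \<open>The restricted abstraction makes the point extensional, as membership in
      \<open>cube\<close> demands.\<close>
    let ?pt = "\<lambda>B. \<lambda>i\<in>{..<n}. if i \<in> B \<union> T then 1 else -1 :: real"
    have "bij_betw ?pt ?B {z \<in> layer n k. \<forall>i\<in>T. z i = 1}"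
    proof (rule bij_betwI[where g = "\<lambda>z. {i\<in>{..<n}. z i = 1} - T"])
      show "?pt \<in> ?B \<rightarrow> {z \<in> layer n k. \<forall>i\<in>T. z i = 1}"
      proof
        fix B assume B: "B \<in> ?B"
        have "{i\<in>{..<n}. ?pt B i = 1} = B \<union> T" using B T by (auto split: if_splits)
        moreover have "card (B \<union> T) = k"
          using B fin True by (subst card_Un_disjoint) (auto intro: finite_subset)
        ultimately have "card {i\<in>{..<n}. ?pt B i = 1} = k" by (simp only:)
        moreover have "?pt B \<in> cube n" by (auto simp: cube_def)
        ultimately show "?pt B \<in> {z \<in> layer n k. \<forall>i\<in>T. z i = 1}"
          unfolding layer_def using T by auto
      qed
      show "(\<lambda>z. {i\<in>{..<n}. z i = 1} - T) \<in> {z \<in> layer n k. \<forall>i\<in>T. z i = 1} \<rightarrow> ?B"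
      proof
        fix z assume z: "z \<in> {z \<in> layer n k. \<forall>i\<in>T. z i = 1}"
        then have "T \<subseteq> {i\<in>{..<n}. z i = 1}" using T by auto
        then have "card ({i\<in>{..<n}. z i = 1} - T) = card {i\<in>{..<n}. z i = 1} - card T"
          using fin by (intro card_Diff_subset)
        then show "{i\<in>{..<n}. z i = 1} - T \<in> ?B" using z by (auto simp: layer_def)
      qed
      show "{i\<in>{..<n}. ?pt B i = 1} - T = B" if "B \<in> ?B" for B
        using that by (auto split: if_splits)
      show "?pt ({i\<in>{..<n}. z i = 1} - T) = z" if "z \<in> {z \<in> layer n k. \<forall>i\<in>T. z i = 1}" for z
      proof
        fix i
        show "?pt ({i\<in>{..<n}. z i = 1} - T) i = z i"
          using that cube_coordinate[of z n i] by (auto simp: layer_def cube_def PiE_def extensional_def)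
      qed
    qed
    then have "card {z \<in> layer n k. \<forall>i\<in>T. z i = 1} = card ?B" by (simp add: bij_betw_same_card)
    also have "\<dots> = card ({..<n} - T) choose (k - card T)" by (rule n_subsets) simp
    also have "card ({..<n} - T) = n - card T" using T fin by (simp add: card_Diff_subset)
    finally show ?thesis using True by simp
  qed
qed

text \<open>Minsky-Papert symmetrization: the average of \<open>f\<close> over the layer
  \<open>k\<close> is a polynomial in \<open>k\<close>. Multiplying by the size of the layer avoids
  a division.\<close>

definition symmetrizes :: "nat \<Rightarrow> nat \<Rightarrow> ((nat \<Rightarrow> real) \<Rightarrow> real) \<Rightarrow> real poly \<Rightarrow> bool" where
  "symmetrizes n d f F \<longleftrightarrow>
     degree F \<le> d \<and> (\<forall>k\<le>n. (\<Sum>z\<in>layer n k. f z) = real (n choose k) * poly F (real k))"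

lemma symmetrizes_scale:
  "symmetrizes n d f F \<Longrightarrow> symmetrizes n d (\<lambda>z. c * f z) (smult c F)"
  by (auto simp: symmetrizes_def sum_distrib_left[symmetric] intro: order_trans[OF degree_smult_le])

lemma symmetrizes_add:
  "symmetrizes n d f F \<Longrightarrow> symmetrizes n d g G \<Longrightarrow> symmetrizes n d (\<lambda>z. f z + g z) (F + G)"
  by (auto simp: symmetrizes_def sum.distrib distrib_left degree_add_le)

lemma symmetrizes_cong:
  assumes "symmetrizes n d f F" "\<And>z. z \<in> cube n \<Longrightarrow> f z = g z"
  shows "symmetrizes n d g F"
proof -
  have "(\<Sum>z\<in>layer n k. g z) = (\<Sum>z\<in>layer n k. f z)" for k
    using assms(2) by (intro sum.cong) (auto simp: layer_def)
  then show ?thesis using assms(1) by (simp add: symmetrizes_def)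
qed

text \<open>With \<open>t = card T\<close>, the fraction of the layer that is 1 on \<open>T\<close>
  is \<open>(k choose t) / (n choose t)\<close>, a multiple of a falling factorial of degree
  \<open>t\<close> in \<open>k\<close>. It also vanishes for \<open>k < t\<close>, as
  required.\<close>

lemma symmetrizes_indicator:
  assumes T: "T \<subseteq> {..<n}" "card T \<le> d"
  shows "\<exists>F. symmetrizes n d (\<lambda>z. if \<forall>i\<in>T. z i = 1 then 1 else 0) F"
proof -
  define t where "t = card T"
  have tn: "t \<le> n" unfolding t_def using card_mono[OF _ T(1)] by simp
  define F where "F = smult (1 / (fact t * real (n choose t))) (\<Prod>i<t. [:- real i, 1:])"
  have "degree F \<le> degree (\<Prod>i<t. [:- real i, 1:])" unfolding F_def by (rule degree_smult_le)
  also have "\<dots> \<le> (\<Sum>i<t. degree [:- real i, 1:])"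
    using degree_prod_sum_le[of "{..<t}" "\<lambda>i. [:- real i, 1:]"] by (simp add: o_def)
  also have "\<dots> \<le> d" using T by (simp add: t_def)
  finally have deg: "degree F \<le> d" .
  have F: "poly F (real k) = real (k choose t) / real (n choose t)" for k
  proof -
    have "real (k choose t) = (\<Prod>i<t. real k - real i) / fact t"
      by (simp add: binomial_gbinomial gbinomial_prod_rev atLeast0LessThan)
    then show ?thesis by (simp add: F_def poly_prod)
  qed
  have "(\<Sum>z\<in>layer n k. if \<forall>i\<in>T. z i = 1 then 1 else 0) = real (n choose k) * poly F (real k)"
    if k: "k \<le> n" for k
  proof -
    have "(\<Sum>z\<in>layer n k. if \<forall>i\<in>T. z i = 1 then 1 else 0 :: real) = real (card {z \<in> layer n k. \<forall>i\<in>T. z i = 1})"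
      by (subst sum.inter_filter[symmetric]) auto
    also have "\<dots> = (if t \<le> k then real ((n - t) choose (k - t)) else 0)"
      unfolding card_layer_superset[OF T(1)] t_def by simp
    also have "\<dots> = real (n choose k) * poly F (real k)"
    proof (cases "t \<le> k")
      case True
      have "real (n choose k) * real (k choose t) = real (n choose t) * real ((n - t) choose (k - t))"
        using choose_mult[OF True k] by (simp only: of_nat_mult[symmetric])
      then show ?thesis using True tn by (simp add: F field_simps)
    qed (simp add: F)
    finally show ?thesis .
  qed
  then show ?thesis using deg by (auto simp: symmetrizes_def)
qed

text \<open>On the cube \<open>z j\<close> is twice the indicator of \<open>z j = 1\<close>, minus
  1. This moves the coordinates one at a time from the character into the indicator without
  exceeding the budget \<open>card S + card T\<close>, hence the induction over arbitrary
  \<open>T\<close>.\<close>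

lemma symmetrizes_char_indicator:
  assumes "finite S" "S \<subseteq> {..<n}" "T \<subseteq> {..<n}" "card S + card T \<le> d"
  shows "\<exists>F. symmetrizes n d (\<lambda>z. (\<Prod>i\<in>S. z i) * (if \<forall>i\<in>T. z i = 1 then 1 else 0)) F"
  using assms
proof (induction S arbitrary: T rule: finite_induct)
  case empty
  then show ?case using symmetrizes_indicator[of T n d] by simp
next
  case (insert j S)
  have "card (insert j T) \<le> Suc (card T)"
    by (cases "finite T") (auto simp: card_insert_if)
  then have "card S + card (insert j T) \<le> d"
    using insert.hyps insert.prems(3) by simp
  then obtain F where F: "symmetrizes n d (\<lambda>z. (\<Prod>i\<in>S. z i) * (if \<forall>i\<in>insert j T. z i = 1 then 1 else 0)) F"
    using insert.IH[of "insert j T"] insert.prems by auto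
  obtain G where G: "symmetrizes n d (\<lambda>z. (\<Prod>i\<in>S. z i) * (if \<forall>i\<in>T. z i = 1 then 1 else 0)) G"
    using insert.IH[of T] insert.hyps insert.prems by auto
  have "symmetrizes n d (\<lambda>z. (\<Prod>i\<in>insert j S. z i) * (if \<forall>i\<in>T. z i = 1 then 1 else 0))
      (smult 2 F + smult (-1) G)"
  proof (rule symmetrizes_cong[OF symmetrizes_add[OF symmetrizes_scale[OF F] symmetrizes_scale[OF G]]])
    fix z assume "z \<in> cube n"
    then have "z j = 1 \<or> z j = -1" using insert by (intro cube_coordinate) auto
    then show "2 * ((\<Prod>i\<in>S. z i) * (if \<forall>i\<in>insert j T. z i = 1 then 1 else 0)) +
         (-1) * ((\<Prod>i\<in>S. z i) * (if \<forall>i\<in>T. z i = 1 then 1 else 0)) =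
         (\<Prod>i\<in>insert j S. z i) * (if \<forall>i\<in>T. z i = 1 then 1 else 0)"
      using insert by auto
  qed
  then show ?case by blast
qed

lemma cube_span_symmetrizes:
  assumes "cube_span n d f"
  shows "\<exists>F. symmetrizes n d f F"
  using assms
proof (induction rule: cube_span.induct)
  case (char S)
  then show ?case
    using symmetrizes_char_indicator[of S n "{}" d] by (auto intro: finite_subset)
next
  case (scale f c)
  then show ?case by (blast intro: symmetrizes_scale)
next
  case (add f g)
  then show ?case by (blast intro: symmetrizes_add)
next
  case (cong f g)
  then show ?case by (blast intro: symmetrizes_cong)
qed

lemma sum_coordinates_layer:
  assumes "z \<in> layer n k"
  shows "(\<Sum>i<n. z i) = 2 * real k - real n"
proof -
  have "(\<Sum>i<n. z i) = (\<Sum>i<n. 2 * (if z i = 1 then 1 else 0) - 1)"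
    using assms cube_coordinate[of z n] by (intro sum.cong) (force simp: layer_def)+
  also have "\<dots> = 2 * (\<Sum>i<n. if z i = 1 then 1 else 0) - real n"
    by (simp add: sum_subtractf sum_distrib_left)
  also have "(\<Sum>i<n. if z i = 1 then 1 else 0) = real k"
    using assms by (subst sum.inter_filter[symmetric]) (auto simp: layer_def)
  finally show ?thesis .
qed

lemma layer_nonempty:
  assumes "k \<le> n"
  shows "layer n k \<noteq> {}"
proof
  assume "layer n k = {}"
  then show False using card_layer_superset[of "{}" n k] assms by simp
qed

text \<open>
  Symmetrizing \<open>p q\<close> and \<open>q\<^sup>2\<close> instead of \<open>p\<close> and \<open>q\<close> keeps the denominator positive.
\<close>

lemma MAJ_approx_univariate:
  assumes p: "cube_span n d p" and q: "cube_span n d q" and q0: "\<And>z. z \<in> cube n \<Longrightarrow> q z \<noteq> 0"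
    and approx: "\<And>z. z \<in> cube n \<Longrightarrow> \<bar>MAJ n z - p z / q z\<bar> \<le> \<epsilon>"
  obtains P Q :: "real poly" where "degree P \<le> 2 * d" "degree Q \<le> 2 * d"
    "\<And>k. k \<le> n \<Longrightarrow> 0 < poly Q (real k)"
    "\<And>k. k \<le> n \<Longrightarrow> \<bar>(if n < 2 * k then 1 else -1) * poly Q (real k) - poly P (real k)\<bar> \<le> \<epsilon> * poly Q (real k)"
proof -
  obtain P where P: "symmetrizes n (d + d) (\<lambda>z. p z * q z) P"
    using cube_span_symmetrizes[OF cube_span_mult[OF p q]] by blast
  obtain Q where Q: "symmetrizes n (d + d) (\<lambda>z. q z * q z) Q"
    using cube_span_symmetrizes[OF cube_span_mult[OF q q]] by blast
  show ?thesis
  proof (rule that[of P Q])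
    show "degree P \<le> 2 * d" "degree Q \<le> 2 * d" using P Q by (auto simp: symmetrizes_def)
    fix k assume k: "k \<le> n"
    let ?s = "if n < 2 * k then 1 else -1 :: real"
    have c: "0 < real (n choose k)" using k by simp
    have eP: "(\<Sum>z\<in>layer n k. p z * q z) = real (n choose k) * poly P (real k)"
      and eQ: "(\<Sum>z\<in>layer n k. q z * q z) = real (n choose k) * poly Q (real k)"
      using P Q k by (auto simp: symmetrizes_def)
    have "0 < (\<Sum>z\<in>layer n k. q z * q z)"
    proof (rule sum_pos)
      fix z assume "z \<in> layer n k"
      then have "q z \<noteq> 0" using q0 by (simp add: layer_def)
      then show "0 < q z * q z" by (auto simp: zero_less_mult_iff)
    qed (simp_all add: layer_nonempty[OF k])
    then show "0 < poly Q (real k)" using c unfolding eQ by (simp add: zero_less_mult_iff)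
    \<comment> \<open>The majority is constant on the layer. Multiplied by the square of
      \<open>q z\<close>, the error bound is linear in \<open>p q\<close> and \<open>q^2\<close> and
      survives summation.\<close>
    have "\<bar>?s * (q z * q z) - p z * q z\<bar> \<le> \<epsilon> * (q z * q z)" if z: "z \<in> layer n k" for z
    proof -
      have zc: "z \<in> cube n" using z by (simp add: layer_def)
      have "MAJ n z = ?s" unfolding MAJ_def sum_coordinates_layer[OF z] by auto
      then have "\<bar>?s - p z / q z\<bar> * (q z * q z) \<le> \<epsilon> * (q z * q z)"
        using approx[OF zc] by (intro mult_right_mono) auto
      also have "\<bar>?s - p z / q z\<bar> * (q z * q z) = \<bar>(?s - p z / q z) * (q z * q z)\<bar>"
        by (simp add: abs_mult)
      also have "(?s - p z / q z) * (q z * q z) = ?s * (q z * q z) - p z * q z"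
        using q0[OF zc] by (simp add: left_diff_distrib)
      finally show ?thesis .
    qed
    then have "\<bar>\<Sum>z\<in>layer n k. ?s * (q z * q z) - p z * q z\<bar> \<le> (\<Sum>z\<in>layer n k. \<epsilon> * (q z * q z))"
      by (intro order_trans[OF sum_abs] sum_mono)
    then have "\<bar>real (n choose k) * (?s * poly Q (real k) - poly P (real k))\<bar> \<le> real (n choose k) * (\<epsilon> * poly Q (real k))"
      unfolding sum_subtractf sum_distrib_left[symmetric] eP eQ by (simp only: right_diff_distrib mult.left_commute)
    then show "\<bar>?s * poly Q (real k) - poly P (real k)\<bar> \<le> \<epsilon> * poly Q (real k)"
      using c by (simp only: abs_mult abs_of_pos mult_le_cancel_left_pos)
  qed
qed

text \<open>The majority changes sign between the layers \<open>n div 2\<close> and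
  \<open>n div 2 + 1\<close>; an affine substitution moves this change to the origin. For even
  \<open>n\<close> the layer 0 is left out to keep the points symmetric.\<close>

lemma MAJ_approx_univariate_odd:
  assumes "cube_span n d p" "cube_span n d q" "\<And>z. z \<in> cube n \<Longrightarrow> q z \<noteq> 0"
    and "\<And>z. z \<in> cube n \<Longrightarrow> \<bar>MAJ n z - p z / q z\<bar> \<le> \<epsilon>"
  obtains P Q :: "real poly" where "degree P \<le> 2 * d" "degree Q \<le> 2 * d"
    "\<And>j. j < (n + 1) div 2 \<Longrightarrow> 0 < poly Q (2 * real j + 1) \<and>
        \<bar>poly Q (2 * real j + 1) - poly P (2 * real j + 1)\<bar> \<le> \<epsilon> * poly Q (2 * real j + 1)"
    "\<And>j. j < (n + 1) div 2 \<Longrightarrow> 0 < poly Q (- (2 * real j + 1)) \<and>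
        \<bar>poly Q (- (2 * real j + 1)) + poly P (- (2 * real j + 1))\<bar> \<le> \<epsilon> * poly Q (- (2 * real j + 1))"
proof -
  obtain P Q :: "real poly" where deg: "degree P \<le> 2 * d" "degree Q \<le> 2 * d"
    and pos: "\<And>k. k \<le> n \<Longrightarrow> 0 < poly Q (real k)"
    and app: "\<And>k. k \<le> n \<Longrightarrow> \<bar>(if n < 2 * k then 1 else -1) * poly Q (real k) - poly P (real k)\<bar> \<le> \<epsilon> * poly Q (real k)"
    using MAJ_approx_univariate[OF assms] by metis
  define h where "h = n div 2"
  \<comment> \<open>This sends the points 1 and -1 to the layers \<open>h + 1\<close> and
    \<open>h\<close>, and steps of 2 to steps of 1.\<close>
  define l :: "real poly" where "l = [:real h + 1 / 2, 1 / 2:]"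
  have lp: "poly l (2 * real j + 1) = real (h + 1 + j)" for j
    by (simp add: l_def field_simps)
  have ln: "poly l (- (2 * real j + 1)) = real (h - j)" if "j \<le> h" for j
    using that by (simp add: l_def field_simps of_nat_diff)
  show ?thesis
  proof (rule that[of "P \<circ>\<^sub>p l" "Q \<circ>\<^sub>p l"])
    show "degree (P \<circ>\<^sub>p l) \<le> 2 * d" "degree (Q \<circ>\<^sub>p l) \<le> 2 * d"
      using deg by (auto simp: degree_pcompose l_def)
    fix j assume j: "j < (n + 1) div 2"
    have 1: "h + 1 + j \<le> n" "n < 2 * (h + 1 + j)" using j unfolding h_def by presburger+
    have 2: "h - j \<le> n" "\<not> n < 2 * (h - j)" "j \<le> h" using j unfolding h_def by presburger+
    show "0 < poly (Q \<circ>\<^sub>p l) (2 * real j + 1) \<and>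
        \<bar>poly (Q \<circ>\<^sub>p l) (2 * real j + 1) - poly (P \<circ>\<^sub>p l) (2 * real j + 1)\<bar> \<le> \<epsilon> * poly (Q \<circ>\<^sub>p l) (2 * real j + 1)"
      unfolding poly_pcompose lp using pos[OF 1(1)] app[OF 1(1)] 1(2) by simp
    have "\<bar>- poly Q (real (h - j)) - poly P (real (h - j))\<bar> \<le> \<epsilon> * poly Q (real (h - j))"
      using app[OF 2(1)] 2(2) by simp
    then show "0 < poly (Q \<circ>\<^sub>p l) (- (2 * real j + 1)) \<and>
        \<bar>poly (Q \<circ>\<^sub>p l) (- (2 * real j + 1)) + poly (P \<circ>\<^sub>p l) (- (2 * real j + 1))\<bar> \<le> \<epsilon> * poly (Q \<circ>\<^sub>p l) (- (2 * real j + 1))"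
      unfolding poly_pcompose ln[OF 2(3)] using pos[OF 2(1)] by linarith
  qed
qed

section \<open>Newman's approximants\<close>

text \<open>A Blaschke product of the right half-plane with real zeros, up to sign. The arbitrary
  index set allows repeated zeros.\<close>

definition blaschke :: "'i set \<Rightarrow> ('i \<Rightarrow> real) \<Rightarrow> real \<Rightarrow> real" where
  "blaschke I a x = (\<Prod>i\<in>I. (a i - x) / (a i + x))"

text \<open>For \<open>x >= 0\<close> every factor has absolute value at most 1, so a bound may be
  read off from any convenient subset of factors.\<close>

lemma abs_blaschke_le_subset:
  assumes "finite I" "J \<subseteq> I" "\<And>i. i \<in> I \<Longrightarrow> 0 < a i" "0 \<le> x"
  shows "\<bar>blaschke I a x\<bar> \<le> \<bar>blaschke J a x\<bar>"
proof -
  let ?f = "\<lambda>i. \<bar>(a i - x) / (a i + x)\<bar>"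
  have "\<bar>blaschke I a x\<bar> = prod ?f (I - J) * prod ?f J"
    unfolding blaschke_def abs_prod using assms(1,2) by (rule prod.subset_diff[rotated])
  also have "\<dots> \<le> 1 * prod ?f J"
  proof (intro mult_right_mono prod_le_1 prod_nonneg)
    fix i assume "i \<in> I - J"
    then have "0 < a i" using assms(3) by simp
    then show "0 \<le> ?f i \<and> ?f i \<le> 1" using assms(4) by (simp add: abs_divide divide_le_eq_1)
  qed simp
  finally show ?thesis by (simp add: blaschke_def abs_prod)
qed

text \<open>The factor grows in absolute value with \<open>y / a >= 1\<close>, so the worst case is
  \<open>y = a * B\<close>. The ratio \<open>B = 2\<close> gives 1/3.\<close>

lemma abs_blaschke_factor_le:
  fixes a y B :: real
  assumes "0 < a" "a \<le> y" "y \<le> a * B"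
  shows "\<bar>(a - y) / (a + y)\<bar> \<le> (B - 1) / (B + 1)"
proof -
  have "a * 1 \<le> a * B" using assms by linarith
  then have "1 \<le> B" using assms(1) by (simp only: mult_le_cancel_left_pos)
  then have "(y - a) * (B + 1) \<le> (B - 1) * (a + y)" using assms by (simp add: algebra_simps)
  then have "(y - a) / (a + y) \<le> (B - 1) / (B + 1)"
    using assms \<open>1 \<le> B\<close> by (simp add: divide_le_eq pos_le_divide_eq mult.commute)
  then show ?thesis using assms by (simp add: abs_divide)
qed

lemma geometric_scale:
  fixes b y B :: real
  assumes "b \<le> y" "y \<le> b * B ^ m" "1 \<le> m"
  shows "\<exists>i<m. b * B ^ i \<le> y \<and> y \<le> b * B ^ i * B"
  using assms(3,2)
proof (induction m rule: dec_induct)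
  case base
  then show ?case using assms(1) by auto
next
  case (step m)
  show ?case
  proof (cases "y \<le> b * B ^ m")
    case True
    then show ?thesis using step.IH less_SucI by blast
  next
    case False
    then show ?thesis using step.prems by (intro exI[of _ m]) (auto simp: mult_ac)
  qed
qed

lemma abs_blaschke_geometric_le:
  assumes "0 < b" "1 < B" "b \<le> y" "y \<le> b * B ^ m" "1 \<le> m"
  shows "\<bar>blaschke {..<m} (\<lambda>i. b * B ^ i) y\<bar> \<le> (B - 1) / (B + 1)"
proof -
  obtain i where i: "i < m" "b * B ^ i \<le> y" "y \<le> b * B ^ i * B"
    using geometric_scale[OF assms(3-5)] by blast
  have "\<bar>blaschke {..<m} (\<lambda>i. b * B ^ i) y\<bar> \<le> \<bar>blaschke {i} (\<lambda>i. b * B ^ i) y\<bar>"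
    using assms i by (intro abs_blaschke_le_subset) auto
  also have "\<dots> \<le> (B - 1) / (B + 1)"
    using assms i abs_blaschke_factor_le[of "b * B ^ i" y B] by (simp add: blaschke_def)
  finally show ?thesis .
qed

text \<open>Multiplying numerator and denominator of \<open>(1 - R) / (1 + R)\<close> by the
  positive product of the \<open>a i + y\<close> turns Newman's function into a quotient of
  polynomials.\<close>

lemma newman_quotient:
  fixes a :: "'i \<Rightarrow> real"
  assumes "finite I" "\<And>i. i \<in> I \<Longrightarrow> 0 < a i" "0 < y" "\<bar>blaschke I a y\<bar> < 1"
  shows "(\<Prod>i\<in>I. a i + y) + (\<Prod>i\<in>I. a i - y) \<noteq> 0"
    and "((\<Prod>i\<in>I. a i + y) - (\<Prod>i\<in>I. a i - y)) / ((\<Prod>i\<in>I. a i + y) + (\<Prod>i\<in>I. a i - y))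
      = (1 - blaschke I a y) / (1 + blaschke I a y)"
proof -
  define p where "p = (\<Prod>i\<in>I. a i + y)"
  define R where "R = blaschke I a y"
  have p: "0 < p" unfolding p_def using assms by (intro prod_pos) (auto simp: add_pos_pos)
  have R: "\<bar>R\<bar> < 1" using assms by (simp add: R_def)
  have m: "(\<Prod>i\<in>I. a i - y) = R * p"
    using p by (simp add: R_def blaschke_def prod_dividef p_def[symmetric])
  have "p + R * p = p * (1 + R)" by (simp add: algebra_simps)
  moreover have "p - R * p = p * (1 - R)" by (simp add: algebra_simps)
  ultimately show "(\<Prod>i\<in>I. a i + y) + (\<Prod>i\<in>I. a i - y) \<noteq> 0"
    "((\<Prod>i\<in>I. a i + y) - (\<Prod>i\<in>I. a i - y)) / ((\<Prod>i\<in>I. a i + y) + (\<Prod>i\<in>I. a i - y))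
      = (1 - blaschke I a y) / (1 + blaschke I a y)"
    unfolding m p_def[symmetric] R_def[symmetric] using p R by auto
qed

lemma cube_in_layer:
  assumes "z \<in> cube n"
  obtains k where "k \<le> n" "z \<in> layer n k"
proof -
  have "card {i\<in>{..<n}. z i = 1} \<le> card {..<n}" by (intro card_mono) auto
  then show ?thesis using assms that by (auto simp: layer_def)
qed

text \<open>
  The argument \<open>x = (\<Sum>i. z i) + n - 2 (n div 2) - 1\<close> takes odd values, and its sign is the majority.
\<close>

lemma newman_approx:
  fixes a :: "'i \<Rightarrow> real"
  assumes fin: "finite I" and pos: "\<And>i. i \<in> I \<Longrightarrow> 0 < a i"
    and lt: "\<And>j. j \<le> n div 2 \<Longrightarrow> \<bar>blaschke I a (2 * real j + 1)\<bar> < 1"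
    and err: "\<And>j. j \<le> n div 2 \<Longrightarrow>
      \<bar>1 - c * ((1 - blaschke I a (2 * real j + 1)) / (1 + blaschke I a (2 * real j + 1)))\<bar> \<le> \<epsilon>"
  obtains f g where "cube_span n (card I) f" "cube_span n (card I) g"
    "\<And>z. z \<in> cube n \<Longrightarrow> g z \<noteq> 0" "\<And>z. z \<in> cube n \<Longrightarrow> \<bar>MAJ n z - f z / g z\<bar> \<le> \<epsilon>"
proof -
  define h where "h = n div 2"
  define x where "x z = (\<Sum>i<n. z i) + (real n - 2 * real h - 1)" for z :: "nat \<Rightarrow> real"
  define p where "p z = (\<Prod>i\<in>I. a i + x z)" for z
  define m where "m z = (\<Prod>i\<in>I. a i - x z)" for z
  have x: "cube_span n 1 x"
    unfolding x_def by (intro cube_span.add cube_span_const cube_span_sum cube_span_var) auto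
  have "cube_span n (\<Sum>i\<in>I. 1) p" unfolding p_def
    by (intro cube_span_prod fin cube_span.add cube_span_const x)
  then have p: "cube_span n (card I) p" by simp
  have "cube_span n (\<Sum>i\<in>I. 1) m" unfolding m_def
    by (intro cube_span_prod fin cube_span_diff cube_span_const x)
  then have m: "cube_span n (card I) m" by simp
  have *: "p z + m z \<noteq> 0 \<and> \<bar>MAJ n z - c * (p z - m z) / (p z + m z)\<bar> \<le> \<epsilon>" if z: "z \<in> cube n" for z
  proof -
    obtain k where k: "k \<le> n" "z \<in> layer n k" using cube_in_layer[OF z] .
    have xk: "x z = 2 * real k - 2 * real h - 1" by (simp add: x_def sum_coordinates_layer[OF k(2)])
    show ?thesis
    proof (cases "h < k")
      case True
      define j where "j = k - h - 1"
      have j: "j \<le> n div 2" using k True unfolding j_def h_def by presburger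
      have xj: "x z = 2 * real j + 1" using True by (simp add: xk j_def of_nat_diff)
      have "n < 2 * k" using True unfolding h_def by presburger
      then have M: "MAJ n z = 1" by (simp add: MAJ_def sum_coordinates_layer[OF k(2)])
      show ?thesis
        using newman_quotient[OF fin pos _ lt[OF j]] err[OF j]
        unfolding M p_def m_def xj times_divide_eq_right[symmetric] by simp
    next
      case False
      define j where "j = h - k"
      have j: "j \<le> n div 2" unfolding j_def h_def by simp
      have xj: "x z = - (2 * real j + 1)" using False by (simp add: xk j_def of_nat_diff)
      have "\<not> n < 2 * k" using False unfolding h_def by presburger
      then have M: "MAJ n z = -1" by (simp add: MAJ_def sum_coordinates_layer[OF k(2)])
      define y where "y = 2 * real j + 1"
      \<comment> \<open>Negating the argument swaps \<open>p\<close> and \<open>m\<close>, so the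
        quotient is odd and the estimate at \<open>y > 0\<close> applies.\<close>
      have pz: "p z = (\<Prod>i\<in>I. a i - y)" and mz: "m z = (\<Prod>i\<in>I. a i + y)"
        by (simp_all add: p_def m_def xj y_def algebra_simps)
      define q where "q = (1 - blaschke I a y) / (1 + blaschke I a y)"
      have y: "0 < y" by (simp add: y_def)
      have nq: "m z + p z \<noteq> 0" "(m z - p z) / (m z + p z) = q"
        unfolding pz mz q_def using newman_quotient[OF fin pos y] lt[OF j] by (simp_all add: y_def)
      have "c * (p z - m z) / (p z + m z) = - (c * ((m z - p z) / (m z + p z)))"
        by (simp add: add.commute minus_divide_left right_diff_distrib)
      then have "MAJ n z - c * (p z - m z) / (p z + m z) = - (1 - c * q)"
        unfolding M nq by simp
      moreover have "\<bar>1 - c * q\<bar> \<le> \<epsilon>" using err[OF j] by (simp add: q_def y_def)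
      ultimately show ?thesis using nq(1) by (simp add: add.commute)
    qed
  qed
  show ?thesis
  proof (rule that[of "\<lambda>z. c * (p z - m z)" "\<lambda>z. p z + m z"])
    show "cube_span n (card I) (\<lambda>z. c * (p z - m z))" using p m by (intro cube_span.scale cube_span_diff)
    show "cube_span n (card I) (\<lambda>z. p z + m z)" using p m by (intro cube_span.add)
  qed (use * in auto)
qed

section \<open>Upper bounds in the two ranges of the error\<close>

text \<open>An argument \<open>2 j + 1\<close> up to \<open>k\<close> is a zero of the product; a
  larger one lies within a factor 2 above some \<open>k\<close>-fold zero, whose block alone
  contributes at most \<open>(1 / 3) ^ k\<close>. About \<open>log 2 (2 n / L)\<close> doublings of
  \<open>k\<close> cover the range.\<close>

lemma MAJ_approx_small_error:
  assumes n: "1 \<le> n" and \<epsilon>: "1 / 2 ^ n < \<epsilon>" "\<epsilon> < 1 / 3"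
  obtains d f g where "cube_span n d f" "cube_span n d g"
    "\<And>z. z \<in> cube n \<Longrightarrow> g z \<noteq> 0" "\<And>z. z \<in> cube n \<Longrightarrow> \<bar>MAJ n z - f z / g z\<bar> \<le> \<epsilon>"
    "real d \<le> 9 * (log 2 (2 * real n / log 2 (1 / \<epsilon>)) * log 2 (1 / \<epsilon>))"
proof -
  define L where "L = log 2 (1 / \<epsilon>)"
  define l where "l = log 2 (2 * real n / L)"
  have e0: "0 < \<epsilon>" using \<epsilon>(1) less_trans[of 0 "1 / 2 ^ n" \<epsilon>] by simp
  have L1: "1 \<le> L"
  proof -
    have "log 2 2 \<le> log 2 (1 / \<epsilon>)" using e0 \<epsilon> by (subst log_le_cancel_iff) (auto simp: field_simps)
    then show ?thesis by (simp add: L_def)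
  qed
  \<comment> \<open>Here \<open>\<epsilon> > 1 / 2 ^ n\<close> enters: it makes
    \<open>2 n / L\<close> exceed 2 and hence \<open>l\<close> at least 1.\<close>
  have Ln: "L < real n"
  proof -
    have "log 2 (1 / \<epsilon>) < log 2 (2 ^ n)" using e0 \<epsilon> by (subst log_less_cancel_iff) (auto simp: field_simps)
    then show ?thesis by (simp add: L_def log_nat_power)
  qed
  have l1: "1 \<le> l"
  proof -
    have "log 2 2 \<le> log 2 (2 * real n / L)" using L1 Ln by (subst log_le_cancel_iff) (auto simp: field_simps)
    then show ?thesis by (simp add: l_def)
  qed
  \<comment> \<open>The added 1 gains a further factor 1/3: the error of Newman's function is
    \<open>2 \<bar>R\<bar> / (1 + R)\<close>, at most \<open>3 \<bar>R\<bar>\<close> here, so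
    \<open>R\<close> has to be below \<open>\<epsilon> / 3\<close>.\<close>
  define k where "k = nat \<lceil>L\<rceil> + 1"
  define J where "J = nat \<lceil>l\<rceil>"
  have kL: "L + 1 \<le> real k" "real k \<le> L + 2" using L1 unfolding k_def by linarith+
  have Jl: "l \<le> real J" "real J \<le> l + 1" "1 \<le> J" using l1 unfolding J_def by linarith+
  define I :: "(nat \<times> nat) set" where "I = {..J} \<times> {..<k}"
  \<comment> \<open>Block 0 consists of \<open>1, ..., k\<close>; block \<open>Suc j'\<close>
    repeats \<open>k * 2 ^ j'\<close> with multiplicity \<open>k\<close>.\<close>
  define a :: "nat \<times> nat \<Rightarrow> real" where
    "a = (\<lambda>(j, i). case j of 0 \<Rightarrow> real i + 1 | Suc j' \<Rightarrow> real k * 2 ^ j')"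
  have fin: "finite I" by (simp add: I_def)
  have k0: "0 < real k" using kL L1 by linarith
  have pos: "0 < a i" for i using k0 by (cases i) (auto simp: a_def split: nat.split)
  have third: "(1 / 3) ^ k \<le> \<epsilon> / 3"
  proof -
    have "(1 / 3 :: real) ^ nat \<lceil>L\<rceil> \<le> (1 / 2) ^ nat \<lceil>L\<rceil>" by (intro power_mono) auto
    also have "\<dots> = 2 powr (- real (nat \<lceil>L\<rceil>))" by (simp add: powr_minus_divide powr_realpow power_one_over)
    also have "\<dots> \<le> 2 powr (- L)" using L1 by (intro powr_mono) linarith+
    also have "\<dots> = \<epsilon>" using e0 by (simp add: L_def log_divide)
    finally show ?thesis by (simp add: k_def)
  qed
  have R: "\<bar>blaschke I a (2 * real j + 1)\<bar> \<le> \<epsilon> / 3" if j: "j \<le> n div 2" for j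
  proof (cases "2 * j + 1 \<le> k")
    case True
    have "(0, 2 * j) \<in> I" using True by (simp add: I_def)
    then have "blaschke I a (2 * real j + 1) = 0"
      unfolding blaschke_def using fin by (intro prod_zero bexI[of _ "(0, 2 * j)"]) (auto simp: a_def)
    then show ?thesis using e0 by simp
  next
    case False
    have "real k \<le> real (2 * j + 1)" using False by (subst of_nat_le_iff) simp
    then have y1: "real k \<le> 2 * real j + 1" by simp
    have "2 * real j + 1 \<le> real n + 1" using j by linarith
    also have "\<dots> \<le> 2 * real n" using n by linarith
    also have "\<dots> = L * (2 powr l)" using L1 n by (simp add: l_def)
    also have "\<dots> \<le> real k * 2 powr (real J)" using kL Jl L1 by (intro mult_mono powr_mono) auto
    also have "\<dots> = real k * 2 ^ J" by (simp add: powr_realpow)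
    finally obtain i where i: "i < J" "real k * 2 ^ i \<le> 2 * real j + 1" "2 * real j + 1 \<le> real k * 2 ^ i * 2"
      using geometric_scale[OF y1 _ Jl(3)] by blast
    have "\<bar>blaschke I a (2 * real j + 1)\<bar> \<le> \<bar>blaschke ({Suc i} \<times> {..<k}) a (2 * real j + 1)\<bar>"
      using i pos by (intro abs_blaschke_le_subset fin) (auto simp: I_def)
    also have "blaschke ({Suc i} \<times> {..<k}) a (2 * real j + 1)
        = (\<Prod>u\<in>{Suc i} \<times> {..<k}. (real k * 2 ^ i - (2 * real j + 1)) / (real k * 2 ^ i + (2 * real j + 1)))"
      unfolding blaschke_def by (intro prod.cong) (auto simp: a_def)
    also have "\<dots> = ((real k * 2 ^ i - (2 * real j + 1)) / (real k * 2 ^ i + (2 * real j + 1))) ^ k"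
      by (simp add: card_cartesian_product)
    also have "\<bar>\<dots>\<bar> \<le> (1 / 3) ^ k"
      unfolding power_abs using abs_blaschke_factor_le[OF _ i(2,3)] k0 by (intro power_mono) auto
    finally show ?thesis using third by linarith
  qed
  obtain f g where fg: "cube_span n (card I) f" "cube_span n (card I) g"
    "\<And>z. z \<in> cube n \<Longrightarrow> g z \<noteq> 0" "\<And>z. z \<in> cube n \<Longrightarrow> \<bar>MAJ n z - f z / g z\<bar> \<le> \<epsilon>"
  proof (rule newman_approx[of I a n 1 \<epsilon>])
    fix j assume j: "j \<le> n div 2"
    define r where "r = blaschke I a (2 * real j + 1)"
    have r: "\<bar>r\<bar> \<le> \<epsilon> / 3" using R[OF j] by (simp add: r_def)
    then show "\<bar>blaschke I a (2 * real j + 1)\<bar> < 1" using \<epsilon> by (simp add: r_def)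
    have r1: "2 / 3 \<le> 1 + r" using r \<epsilon> by linarith
    have "\<bar>1 - (1 - r) / (1 + r)\<bar> = 2 * \<bar>r\<bar> / (1 + r)"
    proof -
      have "1 - (1 - r) / (1 + r) = 2 * r / (1 + r)" using r1 by (simp add: field_simps)
      then show ?thesis using r1 by (simp add: abs_divide abs_mult)
    qed
    also have "\<dots> \<le> 2 * (\<epsilon> / 3) / (2 / 3)" using r r1 e0 by (intro frac_le mult_left_mono) auto
    finally show "\<bar>1 - 1 * ((1 - blaschke I a (2 * real j + 1)) / (1 + blaschke I a (2 * real j + 1)))\<bar> \<le> \<epsilon>"
      by (simp add: r_def)
  qed (use fin pos in auto)
  have "real (card I) = (real J + 1) * real k" by (simp add: I_def card_cartesian_product algebra_simps)
  \<comment> \<open>Since \<open>l\<close> and \<open>L\<close> are at least 1,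
    \<open>J + 1 <= l + 2 <= 3 l\<close> and \<open>k <= L + 2 <= 3 L\<close>.\<close>
  also have "\<dots> \<le> (3 * l) * (3 * L)" using Jl kL l1 L1 by (intro mult_mono) auto
  finally have "real (card I) \<le> 9 * (l * L)" by simp
  then show ?thesis using that[OF fg] by (simp add: l_def L_def)
qed

lemma ln_2_ge_half: "1 / 2 \<le> ln (2::real)"
  using ln_le_minus_one[of "1 / 2"] by (simp add: ln_div)

lemma ln_inverse_ge_third:
  fixes \<delta> :: real
  assumes "0 < \<delta>" "\<delta> \<le> 2 / 3"
  shows "1 / 3 \<le> ln (1 / \<delta>)"
  using ln_le_minus_one[of \<delta>] assms by (simp add: ln_div)

text \<open>Simple zeros in geometric progression of ratio \<open>B\<close> keep
  \<open>(1 - R) / (1 + R)\<close> between \<open>1 / B\<close> and \<open>B\<close>; scaling by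
  \<open>c\<close> centres this interval so that it becomes the allowed one around 1.\<close>

lemma MAJ_approx_large_error:
  assumes n: "1 \<le> n" and \<epsilon>: "1 / 3 \<le> \<epsilon>" "\<epsilon> < 1"
  obtains d f g where "cube_span n d f" "cube_span n d g"
    "\<And>z. z \<in> cube n \<Longrightarrow> g z \<noteq> 0" "\<And>z. z \<in> cube n \<Longrightarrow> \<bar>MAJ n z - f z / g z\<bar> \<le> \<epsilon>"
    "real d \<le> 7 * (1 + ln (real n) / ln (1 / (1 - \<epsilon>)))"
proof -
  \<comment> \<open>\<open>B\<close> and \<open>c\<close> solve
    \<open>c * B = 1 + \<epsilon>\<close> and \<open>c / B = 1 - \<epsilon>\<close>.\<close>
  define B where "B = sqrt ((1 + \<epsilon>) / (1 - \<epsilon>))"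
  define c where "c = sqrt ((1 + \<epsilon>) * (1 - \<epsilon>))"
  define m where "m = nat \<lceil>log B (real n + 1)\<rceil>"
  have B1: "1 < B" unfolding B_def using \<epsilon> by (simp add: field_simps)
  have c0: "0 < c" unfolding c_def using \<epsilon> by simp
  have cB: "c * B = 1 + \<epsilon>"
  proof -
    have "c * B = sqrt ((1 + \<epsilon>) * (1 - \<epsilon>) * ((1 + \<epsilon>) / (1 - \<epsilon>)))"
      unfolding c_def B_def by (rule real_sqrt_mult[symmetric])
    also have "(1 + \<epsilon>) * (1 - \<epsilon>) * ((1 + \<epsilon>) / (1 - \<epsilon>)) = (1 + \<epsilon>)\<^sup>2"
      using \<epsilon> by (simp add: power2_eq_square)
    finally show ?thesis using \<epsilon> by simp
  qed
  have cdB: "c / B = 1 - \<epsilon>"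
  proof -
    have "c / B = sqrt ((1 + \<epsilon>) * (1 - \<epsilon>) / ((1 + \<epsilon>) / (1 - \<epsilon>)))"
      unfolding c_def B_def by (rule real_sqrt_divide[symmetric])
    also have "(1 + \<epsilon>) * (1 - \<epsilon>) / ((1 + \<epsilon>) / (1 - \<epsilon>)) = (1 - \<epsilon>)\<^sup>2"
      using \<epsilon> by (simp add: power2_eq_square)
    finally show ?thesis using \<epsilon> by simp
  qed
  have lg: "0 < log B (real n + 1)" using n B1 by (subst zero_less_log_cancel_iff) auto
  have m: "log B (real n + 1) \<le> real m" "real m \<le> log B (real n + 1) + 1" "1 \<le> m"
    using lg unfolding m_def by linarith+
  obtain f g where fg: "cube_span n (card {..<m}) f" "cube_span n (card {..<m}) g"
    "\<And>z. z \<in> cube n \<Longrightarrow> g z \<noteq> 0" "\<And>z. z \<in> cube n \<Longrightarrow> \<bar>MAJ n z - f z / g z\<bar> \<le> \<epsilon>"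
  proof (rule newman_approx[of "{..<m}" "\<lambda>i. 1 * B ^ i" n c \<epsilon>])
    fix j assume j: "j \<le> n div 2"
    define r where "r = blaschke {..<m} (\<lambda>i. 1 * B ^ i) (2 * real j + 1)"
    have "2 * real j + 1 \<le> real n + 1" using j by linarith
    also have "\<dots> = B powr (log B (real n + 1))" using B1 by simp
    also have "\<dots> \<le> B powr (real m)" using m B1 by (intro powr_mono) auto
    also have "\<dots> = 1 * B ^ m" using B1 by (simp add: powr_realpow)
    finally have r: "\<bar>r\<bar> \<le> (B - 1) / (B + 1)"
      unfolding r_def using B1 m(3) by (intro abs_blaschke_geometric_le) auto
    have "(B - 1) / (B + 1) < 1" using B1 by simp
    then have r1: "\<bar>r\<bar> < 1" using r by linarith
    then show "\<bar>blaschke {..<m} (\<lambda>i. 1 * B ^ i) (2 * real j + 1)\<bar> < 1" by (simp add: r_def)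
    have rB: "r * (B + 1) \<le> B - 1" "- r * (B + 1) \<le> B - 1"
      using r B1 by (auto simp: pos_le_divide_eq abs_le_iff)
    have "1 / B \<le> (1 - r) / (1 + r)" using rB B1 r1 by (simp add: field_simps)
    moreover have "(1 - r) / (1 + r) \<le> B" using rB B1 r1 by (simp add: field_simps)
    ultimately have "c * (1 / B) \<le> c * ((1 - r) / (1 + r))" "c * ((1 - r) / (1 + r)) \<le> c * B"
      using c0 by (simp_all only: mult_le_cancel_left_pos)
    then have "\<bar>1 - c * ((1 - r) / (1 + r))\<bar> \<le> \<epsilon>" using cB cdB by simp
    then show "\<bar>1 - c * ((1 - blaschke {..<m} (\<lambda>i. 1 * B ^ i) (2 * real j + 1)) /
        (1 + blaschke {..<m} (\<lambda>i. 1 * B ^ i) (2 * real j + 1)))\<bar> \<le> \<epsilon>"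
      by (simp only: r_def)
  qed (use B1 in auto)
  define l where "l = ln (1 / (1 - \<epsilon>))"
  have l: "1 / 3 \<le> l" unfolding l_def using \<epsilon> by (intro ln_inverse_ge_third) auto
  have lB: "l / 2 \<le> ln B"
  proof -
    have "ln (1 / (1 - \<epsilon>)) \<le> ln ((1 + \<epsilon>) / (1 - \<epsilon>))"
      using \<epsilon> by (subst ln_le_cancel_iff) (auto simp: divide_right_mono)
    then show ?thesis using \<epsilon> by (simp add: B_def l_def ln_sqrt)
  qed
  have "ln (real n + 1) \<le> ln (2 * real n)" using n by (subst ln_le_cancel_iff) auto
  also have "\<dots> = ln 2 + ln (real n)" using n by (simp add: ln_mult)
  finally have ln: "ln (real n + 1) \<le> 1 + ln (real n)" using ln_2_less_1 by linarith
  have "real m \<le> 1 + ln (real n + 1) / ln B" using m by (simp add: log_def)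
  also have "\<dots> \<le> 1 + (1 + ln (real n)) / (l / 2)"
    using ln lB l n by (intro add_left_mono frac_le) auto
  also have "\<dots> = 1 + 2 * (1 / l) + 2 * (ln (real n) / l)" by (simp add: add_divide_distrib distrib_left)
  also have "1 / l \<le> 3" using l by (simp add: field_simps)
  \<comment> \<open>\<open>7 = 1 + 2 * 3\<close>, from \<open>1 / l <= 3\<close>.\<close>
  finally have "real m \<le> 7 + 2 * (ln (real n) / l)" by simp
  also have "\<dots> \<le> 7 * (1 + ln (real n) / l)"
  proof -
    have "0 \<le> ln (real n) / l" using n l by simp
    then show ?thesis by simp
  qed
  finally show ?thesis using that[OF fg] by (simp add: l_def)
qed

section \<open>Degree lower bounds\<close>

text \<open>Constants cannot serve both points 1 and -1. Having \<open>d >= 1\<close> later absorbs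
  additive constants and yields the summand 1 of the bound for large errors.\<close>

lemma MAJ_approx_degree_pos:
  assumes n: "1 \<le> n" and \<epsilon>: "\<epsilon> < 1"
    and pq: "cube_span n d p" "cube_span n d q" "\<And>z. z \<in> cube n \<Longrightarrow> q z \<noteq> 0"
      "\<And>z. z \<in> cube n \<Longrightarrow> \<bar>MAJ n z - p z / q z\<bar> \<le> \<epsilon>"
  shows "1 \<le> d"
proof (rule ccontr)
  assume "\<not> 1 \<le> d"
  then have d: "d = 0" by simp
  obtain P Q :: "real poly" where deg: "degree P \<le> 2 * d" "degree Q \<le> 2 * d"
    and 1: "\<And>j. j < (n + 1) div 2 \<Longrightarrow> 0 < poly Q (2 * real j + 1) \<and>
        \<bar>poly Q (2 * real j + 1) - poly P (2 * real j + 1)\<bar> \<le> \<epsilon> * poly Q (2 * real j + 1)"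
    and 2: "\<And>j. j < (n + 1) div 2 \<Longrightarrow> 0 < poly Q (- (2 * real j + 1)) \<and>
        \<bar>poly Q (- (2 * real j + 1)) + poly P (- (2 * real j + 1))\<bar> \<le> \<epsilon> * poly Q (- (2 * real j + 1))"
    using MAJ_approx_univariate_odd[OF pq] by blast
  obtain u where u: "P = [:u:]" using deg(1) d by (auto elim: degree_eq_zeroE)
  obtain v where v: "Q = [:v:]" using deg(2) d by (auto elim: degree_eq_zeroE)
  have "(0::nat) < (n + 1) div 2" using n by simp
  from 1[OF this] 2[OF this] have "0 < v" "\<bar>v - u\<bar> \<le> \<epsilon> * v" "\<bar>v + u\<bar> \<le> \<epsilon> * v" by (simp_all add: u v)
  moreover have "\<epsilon> * v < 1 * v" using \<epsilon> \<open>0 < v\<close> by (intro mult_strict_right_mono)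
  ultimately show False by linarith
qed

text \<open>In the scaled quantities \<open>al = d / lam\<close> and \<open>y = n / lam\<close> the
  separation bound reads \<open>ln y <= 5 + ln al + 32 al\<close>. Since \<open>y >= 1\<close>, it
  forces \<open>al\<close> above a constant, after which every term on the right is at most a
  multiple of \<open>al\<close>.\<close>

lemma MAJ_approx_degree_ge_small_error:
  assumes n: "1 \<le> n" and \<epsilon>: "1 / 2 ^ n < \<epsilon>" "\<epsilon> < 1 / 3"
    and pq: "cube_span n d p" "cube_span n d q" "\<And>z. z \<in> cube n \<Longrightarrow> q z \<noteq> 0"
      "\<And>z. z \<in> cube n \<Longrightarrow> \<bar>MAJ n z - p z / q z\<bar> \<le> \<epsilon>"
  shows "1 / 94000 * (log 2 (2 * real n / log 2 (1 / \<epsilon>)) * log 2 (1 / \<epsilon>)) \<le> real d"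
proof -
  have e0: "0 < \<epsilon>" using \<epsilon>(1) less_trans[of 0 "1 / 2 ^ n" \<epsilon>] by simp
  have d1: "1 \<le> d" using MAJ_approx_degree_pos[OF n _ pq] \<epsilon> by simp
  obtain P Q :: "real poly" where deg: "degree P \<le> 2 * d" "degree Q \<le> 2 * d"
    and 1: "\<And>j. j < (n + 1) div 2 \<Longrightarrow> 0 < poly Q (2 * real j + 1) \<and>
        \<bar>poly Q (2 * real j + 1) - poly P (2 * real j + 1)\<bar> \<le> \<epsilon> * poly Q (2 * real j + 1)"
    and 2: "\<And>j. j < (n + 1) div 2 \<Longrightarrow> 0 < poly Q (- (2 * real j + 1)) \<and>
        \<bar>poly Q (- (2 * real j + 1)) + poly P (- (2 * real j + 1))\<bar> \<le> \<epsilon> * poly Q (- (2 * real j + 1))"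
    using MAJ_approx_univariate_odd[OF pq] by blast
  \<comment> \<open>The bound on \<open>s - t\<close> makes \<open>t\<close> positive, so
    \<open>s + t >= s\<close> and the ratio of \<open>Q - P\<close> to \<open>Q + P\<close> is at
    most \<open>\<epsilon>\<close>. At the negative points \<open>t\<close> is
    \<open>- P\<close>.\<close>
  have sep: "s + t \<noteq> 0 \<and> \<bar>s - t\<bar> \<le> \<epsilon> * \<bar>s + t\<bar>" if "0 < s" "\<bar>s - t\<bar> \<le> \<epsilon> * s" for s t
  proof -
    have "\<epsilon> * s < 1 * s" using that \<epsilon> by (intro mult_strict_right_mono) auto
    then have st: "s \<le> s + t" using that by linarith
    then have "\<epsilon> * s \<le> \<epsilon> * \<bar>s + t\<bar>" using that e0 by (intro mult_left_mono) auto
    then show ?thesis using that st by linarith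
  qed
  define lam where "lam = ln (1 / \<epsilon>)"
  have "ln (1 / \<epsilon>) * (ln ((2 * real ((n + 1) div 2) + 1) / (4 * real (2 * d) + 1)) - 1) \<le> 4 * pi * real (2 * d)"
  proof (rule degree_ge_of_sign_separation[of "Q - P" _ "Q + P"])
    show "degree (Q - P) \<le> 2 * d" "degree (Q + P) \<le> 2 * d"
      using deg by (auto intro: degree_diff_le degree_add_le)
    fix j assume j: "j < (n + 1) div 2"
    show "poly (Q + P) (2 * real j + 1) \<noteq> 0 \<and>
       \<bar>poly (Q - P) (2 * real j + 1)\<bar> \<le> \<epsilon> * \<bar>poly (Q + P) (2 * real j + 1)\<bar>"
      unfolding poly_add poly_diff using 1[OF j] by (intro sep) auto
    show "poly (Q - P) (- (2 * real j + 1)) \<noteq> 0 \<and>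
       \<bar>poly (Q + P) (- (2 * real j + 1))\<bar> \<le> \<epsilon> * \<bar>poly (Q - P) (- (2 * real j + 1))\<bar>"
      using 2[OF j] sep[of "poly Q (- (2 * real j + 1))" "- poly P (- (2 * real j + 1))"] by simp
  qed (use n e0 \<epsilon> in auto)
  moreover have "4 * pi * real (2 * d) \<le> 32 * real d" using pi_less_4 d1 by simp
  ultimately have main: "lam * (ln ((2 * real ((n + 1) div 2) + 1) / (8 * real d + 1)) - 1) \<le> 32 * real d"
    by (simp add: lam_def)
  have lam: "0 < lam" using e0 \<epsilon> by (simp add: lam_def)
  have lamn: "lam \<le> ln 2 * real n"
  proof -
    have "ln (1 / \<epsilon>) \<le> ln (2 ^ n)" using e0 \<epsilon> by (subst ln_le_cancel_iff) (auto simp: field_simps)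
    then show ?thesis by (simp add: lam_def ln_realpow mult.commute)
  qed
  have ln2: "1 / 2 \<le> ln (2::real)" "ln (2::real) \<le> 1" using ln_2_ge_half ln_2_less_1 by auto
  have "ln 2 * real n \<le> 1 * real n" using ln2 by (intro mult_right_mono) auto
  then have lamn': "lam \<le> real n" using lamn by linarith
  define al where "al = real d / lam"
  define y where "y = real n / lam"
  have al: "0 < al" "real d = al * lam" using lam d1 by (auto simp: al_def)
  have y: "1 \<le> y" "real n = y * lam" using lam lamn' by (auto simp: y_def)
  have ly: "ln y \<le> 5 + ln al + 32 * al"
  proof -
    have "y / (9 * al) = real n / (9 * real d)" using lam unfolding al(2) y(2) by simp
    also have "\<dots> \<le> (2 * real ((n + 1) div 2) + 1) / (8 * real d + 1)"
      using d1 n by (intro frac_le) linarith+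
    finally have "ln (y / (9 * al)) \<le> ln ((2 * real ((n + 1) div 2) + 1) / (8 * real d + 1))"
      using y al by (subst ln_le_cancel_iff) (auto intro!: divide_pos_pos)
    then have "lam * (ln (y / (9 * al)) - 1) \<le> lam * (ln ((2 * real ((n + 1) div 2) + 1) / (8 * real d + 1)) - 1)"
      using lam by (intro mult_left_mono) auto
    also have "\<dots> \<le> lam * (32 * al)" using main al(2) by (simp add: mult_ac)
    finally have "ln (y / (9 * al)) - 1 \<le> 32 * al" using lam by (simp only: mult_le_cancel_left_pos)
    moreover have "ln (y / (9 * al)) = ln y - (ln 9 + ln al)" using y al by (simp add: ln_div ln_mult)
    moreover have "ln (9::real) = 2 * ln 3" using ln_realpow[of 3 2] by simp
    moreover have "ln (3::real) \<le> 2" using ln_le_minus_one[of 3] by simp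
    ultimately show ?thesis by linarith
  qed
  \<comment> \<open>Below \<open>1 / 4096 = 2 ^ (-12)\<close> the term \<open>ln al\<close> is at
    most \<open>- 12 ln 2 <= - 6\<close>, which outweighs \<open>5 + 32 al\<close>.\<close>
  have al_ge: "1 / 4096 \<le> al"
  proof (rule ccontr)
    assume "\<not> 1 / 4096 \<le> al"
    then have lt: "al < 1 / 4096" by simp
    then have "ln al \<le> ln (1 / 4096)" using al by (subst ln_le_cancel_iff) auto
    also have "\<dots> = - 12 * ln 2" using ln_realpow[of 2 12] by (simp add: ln_div)
    finally have "ln y < 0" using ly lt ln2 by linarith
    then show False using y ln_ge_zero[OF y(1)] by linarith
  qed
  have "ln y \<le> 21000 * al" using ly ln_le_minus_one[of al] al al_ge by linarith
  define L where "L = log 2 (1 / \<epsilon>)"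
  have Llam: "L * ln 2 = lam" using ln2 by (simp add: L_def lam_def log_def)
  then have L0: "0 < L" using lam ln2 by (metis zero_less_mult_pos2 ln_gt_zero one_less_numeral_iff semiring_norm(76))
  have lamL: "lam \<le> L" using Llam ln2 L0 mult_left_mono[of "ln 2" 1 L] by simp
  have "log 2 (2 * real n / L) \<le> log 2 (2 * y)"
    unfolding y_def using lam lamL n L0 by (subst log_le_cancel_iff) (auto intro!: frac_le)
  also have "\<dots> = 1 + ln y / ln 2" using y by (simp add: log_mult log_def add_divide_distrib ln_mult)
  also have "\<dots> \<le> 4096 * al + (21000 * al) / (1 / 2)"
    using al_ge \<open>ln y \<le> 21000 * al\<close> ln2 al by (intro add_mono frac_le) auto
  finally have l: "log 2 (2 * real n / L) \<le> 47000 * al" using al by simp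
  have LL: "L \<le> 2 * lam" using Llam ln2 L0 mult_left_mono[of "1/2" "ln 2" L] by simp
  have "log 2 (2 * real n / L) * L \<le> 47000 * al * L" using l L0 by (intro mult_right_mono) auto
  also have "\<dots> \<le> 47000 * al * (2 * lam)" using LL al by (intro mult_left_mono) auto
  also have "\<dots> = 94000 * real d" using al(2) by simp
  finally show ?thesis by (simp add: L_def)
qed

text \<open>With \<open>y = t / s\<close> in \<open>[\<delta>, 2 - \<delta>]\<close>, the
  progression of ratio 2 from \<open>\<delta>\<close> covers \<open>y\<close> and gives a Blaschke
  product of size at most 1/3. Clearing \<open>s\<close> from the factors leaves polynomial
  expressions in \<open>s\<close> and \<open>t\<close>, to be used for \<open>Q\<close> and
  \<open>P\<close>.\<close>

lemma blaschke_composition: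
  fixes s t \<delta> :: real
  assumes s: "0 < s" "\<bar>s - t\<bar> \<le> (1 - \<delta>) * s" and \<delta>: "0 < \<delta>" "2 \<le> \<delta> * 2 ^ m" "1 \<le> m"
  shows "(\<Prod>i<m. \<delta> * 2 ^ i * s + t) \<noteq> 0 \<and>
    \<bar>\<Prod>i<m. \<delta> * 2 ^ i * s - t\<bar> \<le> 1 / 3 * \<bar>\<Prod>i<m. \<delta> * 2 ^ i * s + t\<bar>"
proof -
  define y where "y = t / s"
  have t: "t = y * s" using s by (simp add: y_def)
  have "s - t = (1 - y) * s" by (simp add: t left_diff_distrib)
  then have "\<bar>s - t\<bar> = \<bar>1 - y\<bar> * s" using s(1) by (simp only: abs_mult abs_of_pos)
  then have "\<bar>1 - y\<bar> * s \<le> (1 - \<delta>) * s" using s by simp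
  then have "\<bar>1 - y\<bar> \<le> 1 - \<delta>" using s by (simp only: mult_le_cancel_right_pos)
  then have y: "\<delta> \<le> y" "y \<le> \<delta> * 2 ^ m" using \<delta> by linarith+
  have R: "\<bar>blaschke {..<m} (\<lambda>i. \<delta> * 2 ^ i) y\<bar> \<le> 1 / 3"
    using abs_blaschke_geometric_le[of \<delta> 2 y m] y \<delta> by simp
  have p: "0 < (\<Prod>i<m. \<delta> * 2 ^ i * s + t)"
    using s \<delta> y t by (intro prod_pos) (auto intro!: add_pos_pos mult_pos_pos)
  have "\<bar>blaschke {..<m} (\<lambda>i. \<delta> * 2 ^ i) y\<bar> = \<bar>\<Prod>i<m. (\<delta> * 2 ^ i * s - t) / (\<delta> * 2 ^ i * s + t)\<bar>"
    unfolding blaschke_def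
  proof (intro arg_cong[where f = abs] prod.cong refl)
    fix i
    show "(\<delta> * 2 ^ i - y) / (\<delta> * 2 ^ i + y) = (\<delta> * 2 ^ i * s - t) / (\<delta> * 2 ^ i * s + t)"
      using s unfolding t by (simp flip: left_diff_distrib distrib_right)
  qed
  also have "\<dots> = \<bar>\<Prod>i<m. \<delta> * 2 ^ i * s - t\<bar> / (\<Prod>i<m. \<delta> * 2 ^ i * s + t)"
    using p by (simp add: prod_dividef abs_divide)
  finally have "\<bar>\<Prod>i<m. \<delta> * 2 ^ i * s - t\<bar> \<le> 1 / 3 * (\<Prod>i<m. \<delta> * 2 ^ i * s + t)"
    using R p by (simp add: pos_divide_le_eq)
  then show ?thesis using p by (intro conjI; linarith)
qed

text \<open>Composition with \<open>m\<close> factors multiplies the degree by \<open>m\<close>, of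
  order \<open>ln (1 / \<delta>)\<close>, and yields separation with the constant ratio 1/3. That
  needs degree of order at least \<open>ln n\<close>, so \<open>d\<close> is at least of order
  \<open>ln n / ln (1 / \<delta>)\<close>.\<close>

lemma MAJ_approx_degree_ge_large_error:
  assumes n: "1 \<le> n" and \<epsilon>: "1 / 3 \<le> \<epsilon>" "\<epsilon> < 1"
    and pq: "cube_span n d p" "cube_span n d q" "\<And>z. z \<in> cube n \<Longrightarrow> q z \<noteq> 0"
      "\<And>z. z \<in> cube n \<Longrightarrow> \<bar>MAJ n z - p z / q z\<bar> \<le> \<epsilon>"
  shows "1 / 433 * (1 + ln (real n) / ln (1 / (1 - \<epsilon>))) \<le> real d"
proof -
  define \<delta> where "\<delta> = 1 - \<epsilon>"
  have \<delta>: "0 < \<delta>" "\<delta> \<le> 2 / 3" "\<epsilon> = 1 - \<delta>" using \<epsilon> by (auto simp: \<delta>_def)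
  have d1: "1 \<le> d" using MAJ_approx_degree_pos[OF n _ pq] \<epsilon> by simp
  obtain P Q :: "real poly" where deg: "degree P \<le> 2 * d" "degree Q \<le> 2 * d"
    and 1: "\<And>j. j < (n + 1) div 2 \<Longrightarrow> 0 < poly Q (2 * real j + 1) \<and>
        \<bar>poly Q (2 * real j + 1) - poly P (2 * real j + 1)\<bar> \<le> \<epsilon> * poly Q (2 * real j + 1)"
    and 2: "\<And>j. j < (n + 1) div 2 \<Longrightarrow> 0 < poly Q (- (2 * real j + 1)) \<and>
        \<bar>poly Q (- (2 * real j + 1)) + poly P (- (2 * real j + 1))\<bar> \<le> \<epsilon> * poly Q (- (2 * real j + 1))"
    using MAJ_approx_univariate_odd[OF pq] by blast
  \<comment> \<open>The least \<open>m\<close> with \<open>\<delta> * 2 ^ m >= 2\<close>, so that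
    the progression covers all values up to \<open>2 - \<delta>\<close>.\<close>
  define m where "m = nat \<lceil>log 2 (2 / \<delta>)\<rceil>"
  have lg: "1 \<le> log 2 (2 / \<delta>)" using \<delta> by (subst le_log_iff) (auto simp: field_simps)
  have m: "log 2 (2 / \<delta>) \<le> real m" "real m \<le> log 2 (2 / \<delta>) + 1" "1 \<le> m"
    using lg unfolding m_def by linarith+
  have "2 / \<delta> = 2 powr (log 2 (2 / \<delta>))" using \<delta> by simp
  also have "\<dots> \<le> 2 powr real m" using m by (intro powr_mono) auto
  finally have m2: "2 \<le> \<delta> * 2 ^ m" using \<delta> by (simp add: powr_realpow field_simps)
  define U where "U = (\<Prod>i<m. smult (\<delta> * 2 ^ i) Q - P)"
  define V where "V = (\<Prod>i<m. smult (\<delta> * 2 ^ i) Q + P)"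
  have "ln (1 / (1 / 3)) * (ln ((2 * real ((n + 1) div 2) + 1) / (4 * real (2 * d * m) + 1)) - 1) \<le> 4 * pi * real (2 * d * m)"
  proof (rule degree_ge_of_sign_separation[of U _ V])
    have "degree U \<le> (\<Sum>i<m. degree (smult (\<delta> * 2 ^ i) Q - P))"
      unfolding U_def using degree_prod_sum_le[of "{..<m}" "\<lambda>i. smult (\<delta> * 2 ^ i) Q - P"] by (simp add: o_def)
    also have "\<dots> \<le> (\<Sum>i<m. 2 * d)"
      using deg by (intro sum_mono degree_diff_le) (auto intro: order_trans[OF degree_smult_le])
    finally show "degree U \<le> 2 * d * m" by (simp add: mult.commute)
    have "degree V \<le> (\<Sum>i<m. degree (smult (\<delta> * 2 ^ i) Q + P))"
      unfolding V_def using degree_prod_sum_le[of "{..<m}" "\<lambda>i. smult (\<delta> * 2 ^ i) Q + P"] by (simp add: o_def)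
    also have "\<dots> \<le> (\<Sum>i<m. 2 * d)"
      using deg by (intro sum_mono degree_add_le) (auto intro: order_trans[OF degree_smult_le])
    finally show "degree V \<le> 2 * d * m" by (simp add: mult.commute)
    fix j assume j: "j < (n + 1) div 2"
    show "poly V (2 * real j + 1) \<noteq> 0 \<and> \<bar>poly U (2 * real j + 1)\<bar> \<le> 1 / 3 * \<bar>poly V (2 * real j + 1)\<bar>"
      using blaschke_composition[of "poly Q (2 * real j + 1)" "poly P (2 * real j + 1)" \<delta> m] 1[OF j] \<delta> m m2
      unfolding U_def V_def poly_prod by simp
    \<comment> \<open>Reversing the sign of \<open>P\<close> exchanges the factors of
      \<open>U\<close> and \<open>V\<close>.\<close>
    show "poly U (- (2 * real j + 1)) \<noteq> 0 \<and> \<bar>poly V (- (2 * real j + 1))\<bar> \<le> 1 / 3 * \<bar>poly U (- (2 * real j + 1))\<bar>"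
      using blaschke_composition[of "poly Q (- (2 * real j + 1))" "- poly P (- (2 * real j + 1))" \<delta> m] 2[OF j] \<delta> m m2
      unfolding U_def V_def poly_prod by simp
  qed (use n in auto)
  moreover define N where "N = real d * real m"
  moreover have N1: "1 \<le> N" unfolding N_def using d1 m(3) mult_mono[of 1 "real d" 1 "real m"] by simp
  moreover have "pi * (8 * N) \<le> 4 * (8 * N)" using N1 pi_less_4 by (intro mult_right_mono) auto
  ultimately have main: "ln 3 * (ln ((2 * real ((n + 1) div 2) + 1) / (8 * N + 1)) - 1) \<le> 32 * N"
    by (simp add: mult_ac)
  define T where "T = ln ((2 * real ((n + 1) div 2) + 1) / (8 * N + 1)) - 1"
  have ln3: "2 / 3 \<le> ln (3::real)" "ln (3::real) \<le> 2"
    using ln_le_minus_one[of "1 / 3"] ln_le_minus_one[of 3] by (auto simp: ln_div)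
  have T: "T \<le> 48 * N"
  proof (cases "0 \<le> T")
    case True
    then have "2 / 3 * T \<le> ln 3 * T" using ln3 by (intro mult_right_mono) auto
    then show ?thesis using main by (simp add: T_def)
  qed (use N1 in simp)
  have "real n / (9 * N) \<le> (2 * real ((n + 1) div 2) + 1) / (8 * N + 1)"
    using N1 n by (intro frac_le) linarith+
  then have "ln (real n / (9 * N)) \<le> T + 1"
    unfolding T_def diff_add_cancel using N1 n
    by (subst ln_le_cancel_iff) (auto intro!: divide_pos_pos)
  moreover have "ln (real n / (9 * N)) = ln (real n) - (ln 9 + ln N)" using n N1 by (simp add: ln_div ln_mult)
  moreover have "ln (9::real) = 2 * ln 3" using ln_realpow[of 3 2] by simp
  moreover have "ln N \<le> N - 1" using N1 by (intro ln_le_minus_one) auto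
  ultimately have lnN: "ln (real n) \<le> 54 * N" using T ln3 N1 by linarith
  define l where "l = ln (1 / \<delta>)"
  have l: "1 / 3 \<le> l" unfolding l_def using \<delta> by (intro ln_inverse_ge_third)
  have "log 2 (2 / \<delta>) = 1 + l / ln 2" using \<delta> by (simp add: l_def log_def ln_div diff_divide_distrib add_divide_distrib)
  also have "l / ln 2 \<le> l / (1 / 2)" using l ln_2_ge_half by (intro divide_left_mono) auto
  finally have m8: "real m \<le> 8 * l" using m(2) l by simp
  have "ln (real n) \<le> 54 * (real d * (8 * l))"
    using lnN mult_left_mono[OF m8, of "real d"] by (simp add: N_def)
  then have "ln (real n) / l \<le> 432 * real d" using l by (simp add: pos_divide_le_eq mult_ac)
  \<comment> \<open>\<open>433 = 54 * 8 + 1\<close>, the last unit covering the summand 1 through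
    \<open>d >= 1\<close>.\<close>
  then show ?thesis using d1 by (simp add: l_def \<delta>_def)
qed

theorem theorem1p7:
  shows "(\<exists>c C :: real. 0 < c \<and> 0 < C \<and>
      (\<forall>(n::nat) (\<epsilon>::real). 1 \<le> n \<longrightarrow> 1 / 2 ^ n < \<epsilon> \<longrightarrow> \<epsilon> < 1 / 3 \<longrightarrow>
        c * (log 2 (2 * real n / log 2 (1 / \<epsilon>)) * log 2 (1 / \<epsilon>))
          \<le> real (rdeg n (cube n) \<epsilon> (MAJ n)) \<and>
        real (rdeg n (cube n) \<epsilon> (MAJ n))
          \<le> C * (log 2 (2 * real n / log 2 (1 / \<epsilon>)) * log 2 (1 / \<epsilon>))))
    \<and> (\<exists>c C :: real. 0 < c \<and> 0 < C \<and>
      (\<forall>(n::nat) (\<epsilon>::real). 1 \<le> n \<longrightarrow> 1 / 3 \<le> \<epsilon> \<longrightarrow> \<epsilon> < 1 \<longrightarrow>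
        c * (1 + log 2 (real n) / log 2 (1 / (1 - \<epsilon>)))
          \<le> real (rdeg n (cube n) \<epsilon> (MAJ n)) \<and>
        real (rdeg n (cube n) \<epsilon> (MAJ n))
          \<le> C * (1 + log 2 (real n) / log 2 (1 / (1 - \<epsilon>)))))"
proof (intro conjI)
  show "\<exists>c C :: real. 0 < c \<and> 0 < C \<and>
      (\<forall>(n::nat) (\<epsilon>::real). 1 \<le> n \<longrightarrow> 1 / 2 ^ n < \<epsilon> \<longrightarrow> \<epsilon> < 1 / 3 \<longrightarrow>
        c * (log 2 (2 * real n / log 2 (1 / \<epsilon>)) * log 2 (1 / \<epsilon>))
          \<le> real (rdeg n (cube n) \<epsilon> (MAJ n)) \<and>
        real (rdeg n (cube n) \<epsilon> (MAJ n))
          \<le> C * (log 2 (2 * real n / log 2 (1 / \<epsilon>)) * log 2 (1 / \<epsilon>)))"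
  proof (rule exI[of _ "1 / 94000"], rule exI[of _ 9], intro conjI allI impI)
    fix n :: nat and \<epsilon> :: real
    assume as: "1 \<le> n" "1 / 2 ^ n < \<epsilon>" "\<epsilon> < 1 / 3"
    obtain d f g where fg: "cube_span n d f" "cube_span n d g"
      "\<And>z. z \<in> cube n \<Longrightarrow> g z \<noteq> 0" "\<And>z. z \<in> cube n \<Longrightarrow> \<bar>MAJ n z - f z / g z\<bar> \<le> \<epsilon>"
      and d: "real d \<le> 9 * (log 2 (2 * real n / log 2 (1 / \<epsilon>)) * log 2 (1 / \<epsilon>))"
      using MAJ_approx_small_error[OF as] by blast
    show "real (rdeg n (cube n) \<epsilon> (MAJ n)) \<le> 9 * (log 2 (2 * real n / log 2 (1 / \<epsilon>)) * log 2 (1 / \<epsilon>))"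
      using rdeg_le[OF fg] d by linarith
    \<comment> \<open>An approximant of minimal degree satisfies the premises of the lower bound
      with \<open>d\<close> equal to \<open>rdeg\<close>.\<close>
    obtain p q where "cube_span n (rdeg n (cube n) \<epsilon> (MAJ n)) p" "cube_span n (rdeg n (cube n) \<epsilon> (MAJ n)) q"
      "\<And>z. z \<in> cube n \<Longrightarrow> q z \<noteq> 0" "\<And>z. z \<in> cube n \<Longrightarrow> \<bar>MAJ n z - p z / q z\<bar> \<le> \<epsilon>"
      using rdeg_witness[OF fg] by blast
    from MAJ_approx_degree_ge_small_error[OF as this]
    show "1 / 94000 * (log 2 (2 * real n / log 2 (1 / \<epsilon>)) * log 2 (1 / \<epsilon>)) \<le> real (rdeg n (cube n) \<epsilon> (MAJ n))" .
  qed simp_all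
next
  \<comment> \<open>The quotient is independent of the base, and the bounds for large errors use
    natural logarithms.\<close>
  have log_ratio: "log 2 (real n) / log 2 (1 / (1 - \<epsilon>)) = ln (real n) / ln (1 / (1 - \<epsilon>))" for n :: nat and \<epsilon> :: real
    by (simp add: log_def)
  show "\<exists>c C :: real. 0 < c \<and> 0 < C \<and>
      (\<forall>(n::nat) (\<epsilon>::real). 1 \<le> n \<longrightarrow> 1 / 3 \<le> \<epsilon> \<longrightarrow> \<epsilon> < 1 \<longrightarrow>
        c * (1 + log 2 (real n) / log 2 (1 / (1 - \<epsilon>)))
          \<le> real (rdeg n (cube n) \<epsilon> (MAJ n)) \<and>
        real (rdeg n (cube n) \<epsilon> (MAJ n))
          \<le> C * (1 + log 2 (real n) / log 2 (1 / (1 - \<epsilon>))))"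
    unfolding log_ratio
  proof (rule exI[of _ "1 / 433"], rule exI[of _ 7], intro conjI allI impI)
    fix n :: nat and \<epsilon> :: real
    assume as: "1 \<le> n" "1 / 3 \<le> \<epsilon>" "\<epsilon> < 1"
    obtain d f g where fg: "cube_span n d f" "cube_span n d g"
      "\<And>z. z \<in> cube n \<Longrightarrow> g z \<noteq> 0" "\<And>z. z \<in> cube n \<Longrightarrow> \<bar>MAJ n z - f z / g z\<bar> \<le> \<epsilon>"
      and d: "real d \<le> 7 * (1 + ln (real n) / ln (1 / (1 - \<epsilon>)))"
      using MAJ_approx_large_error[OF as] by blast
    show "real (rdeg n (cube n) \<epsilon> (MAJ n)) \<le> 7 * (1 + ln (real n) / ln (1 / (1 - \<epsilon>)))"
      using rdeg_le[OF fg] d by linarith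
    obtain p q where "cube_span n (rdeg n (cube n) \<epsilon> (MAJ n)) p" "cube_span n (rdeg n (cube n) \<epsilon> (MAJ n)) q"
      "\<And>z. z \<in> cube n \<Longrightarrow> q z \<noteq> 0" "\<And>z. z \<in> cube n \<Longrightarrow> \<bar>MAJ n z - p z / q z\<bar> \<le> \<epsilon>"
      using rdeg_witness[OF fg] by blast
    from MAJ_approx_degree_ge_large_error[OF as this]
    show "1 / 433 * (1 + ln (real n) / ln (1 / (1 - \<epsilon>))) \<le> real (rdeg n (cube n) \<epsilon> (MAJ n))" .
  qed simp_all
qed

end
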